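(* Let $q$ be a prime power, $m\ge2$ and $1\le k\le q-1$. Then $$\dim\mathrm{PLift}_q(m,k)=\dim\mathrm{PLift}_q(m-1,k)+\dim\mathrm{Lift}_q(m,k-1),$$ where dimensions are over $\mathbb F_q$.
   Context: Projective side. $\mathbb P^m=(\mathbb F_q^{m+1}\setminus\{0\})/\mathbb F_q^\times$; the standard representative of a point is the one whose leftmost non-zero coordinate is $1$. $\mathbb F_q[\mathbf X]^H_v$ is the space of homogeneous polynomials of degree $v$ in $X_0,\dots,X_m$ (together with $0$), and $\mathrm{ev}_{\mathbb P^m}(f)=(f(\mathbf P))_{\mathbf P\in\mathbb P^m}$, evaluating at standard representatives. $\mathrm{PRS}_q(k)=\{\mathrm{ev}_{\mathbb P^1}(g): g\in\mathbb F_q[S,T]^H_k\}$. $\mathrm{Emb}_{\mathbb P}(m)$ is the set of injective $\mathbb F_q$-linear maps $L:\mathbb F_q^2\to\mathbb F_q^{m+1}$, and $f\circ L=f(L(S,T))$. For $m\ge1$, $1\le k\le q-1$ and $v=k+(m-1)(q-1)$, $$\mathrm{PLift}_q(m,k)=\{\mathrm{ev}_{\mathbb P^m}(f): f\in\mathbb F_q[\mathbf X]^H_v,\ \forall L\in\mathrm{Emb}_{\mathbb P}(m),\ \mathrm{ev}_{\mathbb P^1}(f\circ L)\in\mathrm{PRS}_q(k)\}.$$ Affine side. For $f\in\mathbb F_q[X_1,\dots,X_m]$, $\mathrm{ev}_{\mathbb A^m}(f)=(f(\mathbf x))_{\mathbf x\in\mathbb F_q^m}$. $\mathrm{RS}_q(k)=\{\mathrm{ev}_{\mathbb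 A^1}(g): g\in\mathbb F_q[T],\deg g\le k\}$. $\mathrm{Emb}_{\mathbb A}(m)$ is the set of linear maps $L^*=(L_1,\dots,L_m):\mathbb F_q^2\to\mathbb F_q^m$ for which some $L_0$ makes $(L_0,\dots,L_m)$ an element of $\mathrm{Emb}_{\mathbb P}(m)$; $f\circ L^*$ is the univariate polynomial $f(L^*(1,T))$. For $m\ge1$, $0\le k\le q-2$, $$\mathrm{Lift}_q(m,k)=\{\mathrm{ev}_{\mathbb A^m}(f): f\in\mathbb F_q[X_1,\dots,X_m],\ \forall L\in\mathrm{Emb}_{\mathbb A}(m),\ \mathrm{ev}_{\mathbb A^1}(f\circ L)\in\mathrm{RS}_q(k)\}.$$ *)

theory Defs
  imports
    "HOL-Library.Function_Algebras"
    "HOL-Library.Product_Plus"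
    "HOL-Library.Poly_Mapping"
    "HOL-Library.Cardinality"
    "HOL-Computational_Algebra.Polynomial"
begin

text \<open>
  The finite field \<open>\<F>\<^sub>q\<close> is a type \<open>'a :: {field, finite}\<close> with \<open>q = CARD('a)\<close>.
  A vector with coordinates indexed by \<open>I\<close> is a function \<open>nat \<Rightarrow> 'a\<close> vanishing outside \<open>I\<close>,
  so that \<open>\<F>\<^sub>q\<^sup>m\<^sup>+\<^sup>1\<close> has coordinates \<open>0, \<dots>, m\<close> in the projective setting and \<open>\<F>\<^sub>q\<^sup>m\<close> has
  coordinates \<open>1, \<dots>, m\<close> in the affine one.  The source \<open>\<F>\<^sub>q\<^sup>2\<close> of an embedding is \<open>'a \<times> 'a\<close>.
\<close>

definition vecs :: "nat set \<Rightarrow> (nat \<Rightarrow> 'a::zero) set" where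
  "vecs I = {x. \<forall>i. i \<notin> I \<longrightarrow> x i = 0}"

definition fun_scale :: "'a::field \<Rightarrow> ('b \<Rightarrow> 'a) \<Rightarrow> 'b \<Rightarrow> 'a" where
  "fun_scale c w = (\<lambda>x. c * w x)"

definition pair_scale :: "'a::field \<Rightarrow> 'a \<times> 'a \<Rightarrow> 'a \<times> 'a" where
  "pair_scale c u = (c * fst u, c * snd u)"

lemma vector_space_fun_scale: "vector_space fun_scale"
  by unfold_locales (auto simp: fun_scale_def fun_eq_iff algebra_simps)

lemma vector_space_pair_scale: "vector_space pair_scale"
  by unfold_locales (auto simp: pair_scale_def algebra_simps)

abbreviation code_dim :: "('b \<Rightarrow> 'a::field) set \<Rightarrow> nat" where
  "code_dim \<equiv> vector_space.dim fun_scale"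


text \<open>
  Multivariate polynomials in the variables \<open>X\<^sub>0, X\<^sub>1, \<dots>\<close> are finitely supported maps from
  monomials (finitely supported exponent vectors) to coefficients, with the convolution
  product of the library.
\<close>

type_synonym 'a mvpoly = "(nat \<Rightarrow>\<^sub>0 nat) \<Rightarrow>\<^sub>0 'a"

definition Const :: "'a::zero \<Rightarrow> 'a mvpoly" where
  "Const c = Poly_Mapping.single 0 c"

definition Var :: "nat \<Rightarrow> 'a::zero_neq_one mvpoly" where
  "Var i = Poly_Mapping.single (Poly_Mapping.single i 1) 1"

definition polys_in :: "nat set \<Rightarrow> 'a::zero mvpoly set" where
  "polys_in I = {f. \<forall>\<mu>\<in>Poly_Mapping.keys f. Poly_Mapping.keys \<mu> \<subseteq> I}"

definition hom_polys :: "nat set \<Rightarrow> nat \<Rightarrow> 'a::zero mvpoly set" where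
  "hom_polys I v = {f \<in> polys_in I.
     \<forall>\<mu>\<in>Poly_Mapping.keys f. (\<Sum>i\<in>Poly_Mapping.keys \<mu>. Poly_Mapping.lookup \<mu> i) = v}"

text \<open>
  Substitution of \<open>x i\<close> for \<open>X\<^sub>i\<close> in any commutative algebra, with structure map \<open>h\<close> on the
  coefficients.  It serves both for evaluation and for composition with linear forms.
\<close>

definition mv_subst ::
  "('a::zero \<Rightarrow> 'b::comm_semiring_1) \<Rightarrow> (nat \<Rightarrow> 'b) \<Rightarrow> 'a mvpoly \<Rightarrow> 'b" where
  "mv_subst h x f =
     (\<Sum>\<mu>\<in>Poly_Mapping.keys f.
        h (Poly_Mapping.lookup f \<mu>) *
        (\<Prod>i\<in>Poly_Mapping.keys \<mu>. x i ^ Poly_Mapping.lookup \<mu> i))"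

definition mv_eval :: "'a::field mvpoly \<Rightarrow> (nat \<Rightarrow> 'a) \<Rightarrow> 'a" where
  "mv_eval f x = mv_subst (\<lambda>c. c) x f"


text \<open>Points of \<open>\<P>\<^sup>m\<close> are identified with their standard representatives.\<close>

definition proj_points :: "nat \<Rightarrow> (nat \<Rightarrow> 'a::field) set" where
  "proj_points m = {P \<in> vecs {0..m}. \<exists>j\<le>m. P j = 1 \<and> (\<forall>i<j. P i = 0)}"

text \<open>Codewords are extended by \<open>0\<close> outside their index set.\<close>

definition ev_P :: "nat \<Rightarrow> 'a::field mvpoly \<Rightarrow> (nat \<Rightarrow> 'a) \<Rightarrow> 'a" where
  "ev_P m f = (\<lambda>P. if P \<in> proj_points m then mv_eval f P else 0)"

definition ev_A :: "nat \<Rightarrow> 'a::field mvpoly \<Rightarrow> (nat \<Rightarrow> 'a) \<Rightarrow> 'a" where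
  "ev_A m f = (\<lambda>x. if x \<in> vecs {1..m} then mv_eval f x else 0)"


text \<open>The variables \<open>S, T\<close> of binary forms are \<open>X\<^sub>0, X\<^sub>1\<close>.\<close>

definition PRS :: "nat \<Rightarrow> ((nat \<Rightarrow> 'a::field) \<Rightarrow> 'a) set" where
  "PRS k = {ev_P 1 g | g. g \<in> hom_polys {0..1} k}"

definition Emb_P :: "nat \<Rightarrow> ('a::field \<times> 'a \<Rightarrow> nat \<Rightarrow> 'a) set" where
  "Emb_P m = {L. Vector_Spaces.linear pair_scale fun_scale L \<and> inj L \<and> range L \<subseteq> vecs {0..m}}"

text \<open>
  By linearity the \<open>i\<close>-th coordinate of \<open>L(S,T)\<close> is the linear form
  \<open>L(1,0)\<^sub>i S + L(0,1)\<^sub>i T\<close>.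
\<close>

definition comp_P :: "'a::field mvpoly \<Rightarrow> ('a \<times> 'a \<Rightarrow> nat \<Rightarrow> 'a) \<Rightarrow> 'a mvpoly" where
  "comp_P f L = mv_subst Const (\<lambda>i. Const (L (1, 0) i) * Var 0 + Const (L (0, 1) i) * Var 1) f"

definition PLift :: "nat \<Rightarrow> nat \<Rightarrow> ((nat \<Rightarrow> 'a::{field,finite}) \<Rightarrow> 'a) set" where
  "PLift m k = {ev_P m f | f.
     f \<in> hom_polys {0..m} (k + (m - 1) * (CARD('a) - 1)) \<and>
     (\<forall>L\<in>Emb_P m. ev_P 1 (comp_P f L) \<in> PRS k)}"


text \<open>Here \<open>\<A>\<^sup>1\<close> is the field itself, and evaluation of univariate polynomials is \<^const>\<open>poly\<close>.\<close>

definition RS :: "nat \<Rightarrow> ('a::field \<Rightarrow> 'a) set" where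
  "RS k = {poly g | g. degree g \<le> k}"

definition Emb_A :: "nat \<Rightarrow> ('a::field \<times> 'a \<Rightarrow> nat \<Rightarrow> 'a) set" where
  "Emb_A m = {L. Vector_Spaces.linear pair_scale fun_scale L \<and> range L \<subseteq> vecs {1..m} \<and>
     (\<exists>L0. (\<lambda>u. (L u)(0 := L0 u)) \<in> Emb_P m)}"

text \<open>The \<open>i\<close>-th coordinate of \<open>L(1,T)\<close> is \<open>L(1,0)\<^sub>i + L(0,1)\<^sub>i T\<close>.\<close>

definition comp_A :: "'a::field mvpoly \<Rightarrow> ('a \<times> 'a \<Rightarrow> nat \<Rightarrow> 'a) \<Rightarrow> 'a poly" where
  "comp_A f L = mv_subst (\<lambda>c. [:c:]) (\<lambda>i. [:L (1, 0) i, L (0, 1) i:]) f"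

definition Lift :: "nat \<Rightarrow> nat \<Rightarrow> ((nat \<Rightarrow> 'a::{field,finite}) \<Rightarrow> 'a) set" where
  "Lift m k = {ev_A m f | f. f \<in> polys_in {1..m} \<and> (\<forall>L\<in>Emb_A m. poly (comp_A f L) \<in> RS k)}"

end

theory Submission
  imports Defs "HOL-Combinatorics.Transposition"
begin

text \<open>
  Both kinds of codes are spaces of functions.  A lifted projective codeword is the same thing as a
  function \<open>F\<close> on \<open>\<F>\<^sub>q\<^sup>m\<^sup>+\<^sup>1\<close> whose pullback along every linear map from the plane is a binary form of
  degree \<open>k\<close>; maps of rank at most one only express \<open>F (c x) = c\<^sup>k F x\<close>.  A lifted affine codeword is a
  function of degree less than \<open>k\<close> on every line.  Such an \<open>F\<close> is uniquely
  \<open>G(x\<^sub>1, \<dots>, x\<^sub>m) + x\<^sub>0\<^sup>k h(x\<^sub>1/x\<^sub>0, \<dots>, x\<^sub>m/x\<^sub>0)\<close>, with \<open>G\<close> the restriction to \<open>x\<^sub>0 = 0\<close> and \<open>h\<close> affine; every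
  such pair \<open>(G, h)\<close> occurs.  The degree \<open>v = k + (m - 1)(q - 1)\<close> costs nothing: by induction on \<open>m\<close>,
  \<open>G\<close> has a polynomial of degree \<open>v - (q - 1)\<close>, which can be raised by \<open>q - 1\<close>, while \<open>h\<close> has degree less
  than \<open>k\<close> in one variable and may be interpolated in the remaining \<open>m - 1\<close> with degree at most \<open>q - 1\<close> in
  each.
\<close>

section \<open>Powers in a finite field\<close>

text \<open>Multiplication by \<open>x\<close> permutes the non-zero elements, so their product is
  unchanged by the factor \<open>x ^ (CARD('a) - 1)\<close> and can be cancelled.\<close>

lemma power_card_minus_1:
  fixes x :: "'a::{field,finite}"
  assumes "x \<noteq> 0"
  shows "x ^ (CARD('a) - 1) = 1"
proof -
  let ?U = "UNIV - {0::'a}"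
  have "bij_betw (\<lambda>y. x * y) ?U ?U"
    by (rule bij_betw_byWitness[where f' = "\<lambda>y. y / x"]) (use assms in auto)
  then have "(\<Prod>y\<in>?U. x * y) = \<Prod>?U"
    by (rule prod.reindex_bij_betw)
  then have "x ^ card ?U * \<Prod>?U = \<Prod>?U"
    by (simp add: prod.distrib)
  moreover have "\<Prod>?U \<noteq> 0"
    by simp
  ultimately show ?thesis
    by (simp add: card_Diff_singleton)
qed

text \<open>Hence scalars cannot distinguish degree \<open>k\<close> from
  \<open>k + (m - 1) * (q - 1)\<close>. The bound \<open>k \<ge> 1\<close> settles
  \<open>x = 0\<close>, where \<open>0 ^ 0 = 1\<close> would spoil the identity.\<close>

lemma power_eq_power_add_card:
  fixes x :: "'a::{field,finite}"
  assumes "k \<ge> 1"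
  shows "x ^ (k + n * (CARD('a) - 1)) = x ^ k"
proof (cases "x = 0")
  case True
  then show ?thesis using assms by (simp add: zero_power)
next
  case False
  have "x ^ (n * (CARD('a) - 1)) = (x ^ (CARD('a) - 1)) ^ n"
    by (simp add: power_mult[symmetric] mult.commute)
  then show ?thesis
    by (simp add: power_add power_card_minus_1[OF False] del: One_nat_def)
qed

lemma CARD_finite_field_ge_2: "CARD('a::{field,finite}) \<ge> 2"
proof -
  have "card {0, 1::'a} \<le> CARD('a)"
    by (rule card_mono) auto
  then show ?thesis by simp
qed

text \<open>Since \<open>q \<ge> 2\<close> the exponent is positive, so \<open>0\<close> has power
  \<open>0\<close>. Products of such factors serve as indicators of single points.\<close>

lemma indicator_power_card:
  fixes x :: "'a::{field,finite}"
  shows "1 - x ^ (CARD('a) - 1) = (if x = 0 then 1 else 0)"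
  using CARD_finite_field_ge_2[where 'a='a] by (auto simp: power_card_minus_1 power_0_left simp del: One_nat_def)


section \<open>Evaluation of multivariate polynomials\<close>

lemma poly_mapping_single_induct [case_names single add]:
  fixes f :: "'b \<Rightarrow>\<^sub>0 'c::comm_monoid_add"
  assumes single: "\<And>\<mu> c. P (Poly_Mapping.single \<mu> c)"
    and add: "\<And>f g. P f \<Longrightarrow> P g \<Longrightarrow> P (f + g)"
  shows "P f"
proof -
  have "f = (\<Sum>\<mu>\<in>Poly_Mapping.keys f. Poly_Mapping.single \<mu> (Poly_Mapping.lookup f \<mu>))"
    by (rule poly_mapping_eqI) (auto simp: lookup_sum lookup_single when_def in_keys_iff)
  moreover have "P (\<Sum>\<mu>\<in>A. Poly_Mapping.single \<mu> (g \<mu>))" for A g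
  proof (induction A rule: infinite_finite_induct)
    case (insert \<mu> A)
    then show ?case by (simp add: single add)
  \<comment> \<open>The empty sum is the zero polynomial, a monomial with coefficient 0.\<close>
  qed (use single[of _ 0] in simp_all)
  ultimately show ?thesis by metis
qed

definition mono_eval :: "(nat \<Rightarrow> 'a::comm_semiring_1) \<Rightarrow> (nat \<Rightarrow>\<^sub>0 nat) \<Rightarrow> 'a" where
  "mono_eval x \<mu> = (\<Prod>i\<in>Poly_Mapping.keys \<mu>. x i ^ Poly_Mapping.lookup \<mu> i)"

text \<open>Brings monomials with different supports onto one index set, by factors of exponent
  0.\<close>

lemma mono_eval_superset:
  assumes "finite A" and "Poly_Mapping.keys \<mu> \<subseteq> A"
  shows "mono_eval x \<mu> = (\<Prod>i\<in>A. x i ^ Poly_Mapping.lookup \<mu> i)"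
  unfolding mono_eval_def
  by (rule prod.mono_neutral_left) (use assms in \<open>auto simp: in_keys_iff\<close>)

lemma mono_eval_0 [simp]: "mono_eval x 0 = 1"
  by (simp add: mono_eval_def)

lemma mono_eval_single [simp]: "mono_eval x (Poly_Mapping.single i n) = x i ^ n"
  by (simp add: mono_eval_def)

lemma mono_eval_add: "mono_eval x (\<mu> + \<nu>) = mono_eval x \<mu> * mono_eval x \<nu>"
proof -
  let ?A = "Poly_Mapping.keys \<mu> \<union> Poly_Mapping.keys \<nu>"
  have "Poly_Mapping.keys (\<mu> + \<nu>) \<subseteq> ?A"
    by (rule keys_add)
  then show ?thesis
    by (simp add: mono_eval_superset[of ?A] lookup_add power_add prod.distrib)
qed

lemma mv_eval_eq: "mv_eval f x = (\<Sum>\<mu>\<in>Poly_Mapping.keys f. Poly_Mapping.lookup f \<mu> * mono_eval x \<mu>)"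
  by (simp add: mv_eval_def mv_subst_def mono_eval_def)

lemma mv_eval_0 [simp]: "mv_eval 0 x = 0"
  by (simp add: mv_eval_eq)

lemma mv_eval_single [simp]: "mv_eval (Poly_Mapping.single \<mu> c) x = c * mono_eval x \<mu>"
  by (simp add: mv_eval_eq)

lemma mv_eval_add [simp]: "mv_eval (f + g) x = mv_eval f x + mv_eval g x"
  unfolding mv_eval_eq
  by (rule setsum_keys_plus_distrib[where f = "\<lambda>\<mu> c. c * mono_eval x \<mu>"])
    (simp_all add: algebra_simps)

lemma mv_eval_mult [simp]: "mv_eval (f * g) x = mv_eval f x * mv_eval g x"
proof (induction f rule: poly_mapping_single_induct)
  case (single \<mu> c)
  show ?case
    by (induction g rule: poly_mapping_single_induct)
      (simp_all add: mult_single mono_eval_add algebra_simps)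
qed (simp add: algebra_simps)

lemma mv_eval_Const [simp]: "mv_eval (Const c) x = c"
  by (simp add: Const_def)

lemma mv_eval_Var [simp]: "mv_eval (Var i) x = x i"
  by (simp add: Var_def)

lemma mv_eval_1 [simp]: "mv_eval 1 x = 1"
  by (simp flip: single_one)

lemma mv_eval_power [simp]: "mv_eval (f ^ n) x = mv_eval f x ^ n"
  by (induction n) simp_all

lemma mv_eval_sum [simp]: "mv_eval (sum f A) x = (\<Sum>i\<in>A. mv_eval (f i) x)"
  by (induction A rule: infinite_finite_induct) simp_all

lemma mv_eval_prod [simp]: "mv_eval (prod f A) x = (\<Prod>i\<in>A. mv_eval (f i) x)"
  by (induction A rule: infinite_finite_induct) simp_all

lemma mv_eval_cong:
  assumes "f \<in> polys_in I" and "\<And>i. i \<in> I \<Longrightarrow> x i = y i"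
  shows "mv_eval f x = mv_eval f y"
  unfolding mv_eval_eq mono_eval_def
  by (intro sum.cong prod.cong arg_cong2[where f = "(*)"]) (use assms in \<open>auto simp: polys_in_def dest!: bspec subsetD intro!: arg_cong2[where f = power]\<close>)

lemma mv_eval_comp_P: "mv_eval (comp_P f L) x = mv_eval f (\<lambda>i. L (1, 0) i * x 0 + L (0, 1) i * x 1)"
  by (simp add: comp_P_def mv_subst_def mv_eval_eq[of f] mono_eval_def)

lemma poly_comp_A: "poly (comp_A f L) t = mv_eval f (\<lambda>i. L (1, 0) i + t * L (0, 1) i)"
  by (simp add: comp_A_def mv_subst_def mv_eval_eq[of f] mono_eval_def poly_sum poly_prod)


section \<open>Functions given by polynomials\<close>

definition total_deg :: "(nat \<Rightarrow>\<^sub>0 nat) \<Rightarrow> nat" where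
  "total_deg \<mu> = (\<Sum>i\<in>Poly_Mapping.keys \<mu>. Poly_Mapping.lookup \<mu> i)"

lemma total_deg_single [simp]: "total_deg (Poly_Mapping.single i n) = n"
  by (simp add: total_deg_def)

lemma total_deg_add: "total_deg (\<mu> + \<nu>) = total_deg \<mu> + total_deg \<nu>"
  unfolding total_deg_def
  by (rule setsum_keys_plus_distrib[where f = "\<lambda>\<mu> c. c"]) simp_all

lemma hom_polys_iff:
  "f \<in> hom_polys I v \<longleftrightarrow>
    (\<forall>\<mu>\<in>Poly_Mapping.keys f. Poly_Mapping.keys \<mu> \<subseteq> I \<and> total_deg \<mu> = v)"
  by (auto simp: hom_polys_def polys_in_def total_deg_def)

definition poly_fun :: "nat set \<Rightarrow> ((nat \<Rightarrow> 'a::field) \<Rightarrow> 'a) \<Rightarrow> bool" where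
  "poly_fun I \<phi> \<longleftrightarrow> (\<exists>f\<in>polys_in I. \<phi> = mv_eval f)"

text \<open>The codes see only values, so homogeneity becomes a property of functions, and one
  function may have several degrees \<open>v\<close>. Equality is required at every
  \<open>x\<close>, also outside \<open>vecs I\<close>, so sums and products are purely
  pointwise.\<close>

definition hom_fun :: "nat set \<Rightarrow> nat \<Rightarrow> ((nat \<Rightarrow> 'a::field) \<Rightarrow> 'a) \<Rightarrow> bool" where
  "hom_fun I v \<phi> \<longleftrightarrow> (\<exists>f\<in>hom_polys I v. \<phi> = mv_eval f)"

lemma hom_fun_mono: "hom_fun I v \<phi> \<Longrightarrow> I \<subseteq> J \<Longrightarrow> hom_fun J v \<phi>"
  by (fastforce simp: hom_fun_def hom_polys_iff)

lemma hom_fun_0: "hom_fun I v (\<lambda>x. 0)"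
  unfolding hom_fun_def by (rule bexI[of _ 0]) (auto simp: hom_polys_iff fun_eq_iff)

lemma hom_fun_const: "hom_fun I 0 (\<lambda>x. c)"
  unfolding hom_fun_def
  by (rule bexI[of _ "Const c"]) (auto simp: hom_polys_iff fun_eq_iff Const_def total_deg_def)

lemma hom_fun_coord: "i \<in> I \<Longrightarrow> hom_fun I 1 (\<lambda>x. x i)"
  unfolding hom_fun_def
  by (rule bexI[of _ "Var i"]) (auto simp: hom_polys_iff fun_eq_iff Var_def)

lemma hom_fun_add: "hom_fun I v \<phi> \<Longrightarrow> hom_fun I v \<psi> \<Longrightarrow> hom_fun I v (\<lambda>x. \<phi> x + \<psi> x)"
proof -
  assume "hom_fun I v \<phi>" "hom_fun I v \<psi>"
  then obtain f g where fg: "f \<in> hom_polys I v" "g \<in> hom_polys I v" "\<phi> = mv_eval f" "\<psi> = mv_eval g"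
    by (auto simp: hom_fun_def)
  then have "f + g \<in> hom_polys I v"
    using keys_add[of f g] by (auto simp: hom_polys_iff)
  then show ?thesis
    unfolding hom_fun_def using fg by (intro bexI[of _ "f + g"]) auto
qed

lemma hom_fun_mult:
  assumes "hom_fun I v \<phi>" "hom_fun I w \<psi>"
  shows "hom_fun I (v + w) (\<lambda>x. \<phi> x * \<psi> x)"
proof -
  from assms obtain f g where
    fg: "f \<in> hom_polys I v" "g \<in> hom_polys I w" "\<phi> = mv_eval f" "\<psi> = mv_eval g"
    by (auto simp: hom_fun_def)
  have "f * g \<in> hom_polys I (v + w)"
    unfolding hom_polys_iff
  proof
    fix \<mu> assume "\<mu> \<in> Poly_Mapping.keys (f * g)"
    then obtain \<alpha> \<beta> where "\<mu> = \<alpha> + \<beta>" "\<alpha> \<in> Poly_Mapping.keys f" "\<beta> \<in> Poly_Mapping.keys g"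
      using keys_mult[of f g] by blast
    then show "Poly_Mapping.keys \<mu> \<subseteq> I \<and> total_deg \<mu> = v + w"
      using fg(1,2) keys_add[of \<alpha> \<beta>] by (fastforce simp: hom_polys_iff total_deg_add)
  qed
  then show ?thesis
    unfolding hom_fun_def using fg by (intro bexI[of _ "f * g"]) auto
qed

lemma hom_fun_cmult: "hom_fun I v \<phi> \<Longrightarrow> hom_fun I v (\<lambda>x. c * \<phi> x)"
  using hom_fun_mult[OF hom_fun_const] by (metis add_0)

lemma hom_fun_diff: "hom_fun I v \<phi> \<Longrightarrow> hom_fun I v \<psi> \<Longrightarrow> hom_fun I v (\<lambda>x. \<phi> x - \<psi> x)"
  using hom_fun_add[OF _ hom_fun_cmult[of I v \<psi> "-1"]] by simp

lemma hom_fun_sum: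
  "(\<And>j. j \<in> A \<Longrightarrow> hom_fun I v (\<phi> j)) \<Longrightarrow> hom_fun I v (\<lambda>x. \<Sum>j\<in>A. \<phi> j x)"
  by (induction A rule: infinite_finite_induct) (auto intro: hom_fun_0 hom_fun_add)

lemma hom_fun_power: "hom_fun I v \<phi> \<Longrightarrow> hom_fun I (n * v) (\<lambda>x. \<phi> x ^ n)"
  by (induction n) (auto intro: hom_fun_const hom_fun_mult)

lemma hom_fun_coord_power: "i \<in> I \<Longrightarrow> hom_fun I n (\<lambda>x. x i ^ n)"
  using hom_fun_power[OF hom_fun_coord, of i I n] by simp

lemma hom_fun_prod:
  assumes "finite A" and "\<And>j. j \<in> A \<Longrightarrow> hom_fun I v (\<phi> j)"
  shows "hom_fun I (card A * v) (\<lambda>x. \<Prod>j\<in>A. \<phi> j x)"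
  using assms by (induction A rule: finite_induct) (auto intro: hom_fun_const hom_fun_mult)

lemma hom_fun_imp_poly_fun: "hom_fun I v \<phi> \<Longrightarrow> poly_fun I \<phi>"
  by (auto simp: hom_fun_def poly_fun_def hom_polys_def)

lemma poly_fun_add:
  assumes "poly_fun I \<phi>" "poly_fun I \<psi>"
  shows "poly_fun I (\<lambda>x. \<phi> x + \<psi> x)"
proof -
  from assms obtain f g where fg: "f \<in> polys_in I" "g \<in> polys_in I" "\<phi> = mv_eval f" "\<psi> = mv_eval g"
    by (auto simp: poly_fun_def)
  then have "f + g \<in> polys_in I"
    using keys_add[of f g] unfolding polys_in_def by blast
  then show ?thesis
    unfolding poly_fun_def using fg by (intro bexI[of _ "f + g"]) auto
qed

lemma poly_fun_mult:
  assumes "poly_fun I \<phi>" "poly_fun I \<psi>"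
  shows "poly_fun I (\<lambda>x. \<phi> x * \<psi> x)"
proof -
  from assms obtain f g where fg: "f \<in> polys_in I" "g \<in> polys_in I" "\<phi> = mv_eval f" "\<psi> = mv_eval g"
    by (auto simp: poly_fun_def)
  have "f * g \<in> polys_in I"
    unfolding polys_in_def
  proof (rule CollectI, rule ballI)
    fix \<mu> assume "\<mu> \<in> Poly_Mapping.keys (f * g)"
    then obtain \<alpha> \<beta> where "\<mu> = \<alpha> + \<beta>" "\<alpha> \<in> Poly_Mapping.keys f" "\<beta> \<in> Poly_Mapping.keys g"
      using keys_mult[of f g] by blast
    then show "Poly_Mapping.keys \<mu> \<subseteq> I"
      using fg(1,2) keys_add[of \<alpha> \<beta>] by (fastforce simp: polys_in_def)
  qed
  then show ?thesis
    unfolding poly_fun_def using fg by (intro bexI[of _ "f * g"]) auto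
qed

lemmas poly_fun_const = hom_fun_imp_poly_fun[OF hom_fun_const]
lemmas poly_fun_coord = hom_fun_imp_poly_fun[OF hom_fun_coord]

lemma poly_fun_diff: "poly_fun I \<phi> \<Longrightarrow> poly_fun I \<psi> \<Longrightarrow> poly_fun I (\<lambda>x. \<phi> x - \<psi> x)"
  using poly_fun_add[of I \<phi> "\<lambda>x. - 1 * \<psi> x"] poly_fun_mult[OF poly_fun_const, of I \<psi> "-1"] by simp

lemma poly_fun_power: "poly_fun I \<phi> \<Longrightarrow> poly_fun I (\<lambda>x. \<phi> x ^ n)"
  by (induction n) (auto intro: poly_fun_const poly_fun_mult)

lemma poly_fun_sum:
  "(\<And>j. j \<in> A \<Longrightarrow> poly_fun I (\<phi> j)) \<Longrightarrow> poly_fun I (\<lambda>x. \<Sum>j\<in>A. \<phi> j x)"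
  by (induction A rule: infinite_finite_induct) (auto intro: poly_fun_const poly_fun_add)

lemma poly_fun_prod:
  "(\<And>j. j \<in> A \<Longrightarrow> poly_fun I (\<phi> j)) \<Longrightarrow> poly_fun I (\<lambda>x. \<Prod>j\<in>A. \<phi> j x)"
  by (induction A rule: infinite_finite_induct) (auto intro: poly_fun_const poly_fun_mult)

section \<open>Interpolation, and raising the degree by q - 1\<close>

lemma finite_vecs:
  assumes "finite I"
  shows "finite (vecs I :: (nat \<Rightarrow> 'a::{zero,finite}) set)"
  using finite_set_of_finite_funs[OF assms finite, of UNIV "0::'a"]
  by (rule finite_subset[rotated]) (auto simp: vecs_def)

lemma poly_fun_exists:
  fixes h :: "(nat \<Rightarrow> 'a::{field,finite}) \<Rightarrow> 'a"
  assumes "finite I"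
  obtains \<phi> where "poly_fun I \<phi>" "\<And>x. x \<in> vecs I \<Longrightarrow> \<phi> x = h x"
proof
  \<comment> \<open>Lagrange interpolation: on \<open>vecs I\<close> the product is the indicator of
    \<open>x = y\<close>.\<close>
  let ?\<phi> = "\<lambda>x. \<Sum>y\<in>vecs I. h y * (\<Prod>i\<in>I. 1 - (x i - y i) ^ (CARD('a) - 1))"
  show "poly_fun I ?\<phi>"
    by (intro poly_fun_sum poly_fun_mult poly_fun_prod poly_fun_diff poly_fun_power
        poly_fun_const poly_fun_coord)
  fix x :: "nat \<Rightarrow> 'a" assume x: "x \<in> vecs I"
  have "(\<Prod>i\<in>I. 1 - (x i - y i) ^ (CARD('a) - 1)) = (if y = x then 1 else 0)" if y: "y \<in> vecs I" for y
  proof (cases "y = x")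
    case False
    then obtain i where "y i \<noteq> x i" by auto
    with x y have "i \<in> I" "x i - y i \<noteq> 0" by (fastforce simp: vecs_def)+
    with False assms show ?thesis by (auto simp: indicator_power_card simp del: One_nat_def)
  qed (simp add: indicator_power_card del: One_nat_def)
  then have "?\<phi> x = (\<Sum>y\<in>vecs I. if y = x then h y else 0)"
    by (intro sum.cong) auto
  also have "\<dots> = h x"
    using x by (simp add: finite_vecs[OF assms])
  finally show "?\<phi> x = h x" .
qed

text \<open>A monomial of positive degree contains some variable. Multiplying by the power
  \<open>q - 1\<close> of that variable keeps all values: the factor is 1 where the variable is
  non-zero, and elsewhere the monomial vanishes anyway.\<close>

lemma hom_fun_raise_degree:
  fixes \<phi> :: "(nat \<Rightarrow> 'a::{field,finite}) \<Rightarrow> 'a"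
  assumes "hom_fun I v \<phi>" and "v \<ge> 1"
  shows "hom_fun I (v + (CARD('a) - 1)) \<phi>"
proof -
  from assms obtain f where f: "f \<in> hom_polys I v" "\<phi> = mv_eval f"
    by (auto simp: hom_fun_def)
  have "hom_fun I (v + (CARD('a) - 1)) (\<lambda>x. Poly_Mapping.lookup f \<mu> * mono_eval x \<mu>)"
    if \<mu>: "\<mu> \<in> Poly_Mapping.keys f" for \<mu>
  proof -
    have deg: "Poly_Mapping.keys \<mu> \<subseteq> I" "total_deg \<mu> = v"
      using f \<mu> by (auto simp: hom_polys_iff)
    then have "Poly_Mapping.keys \<mu> \<noteq> {}"
      using \<open>v \<ge> 1\<close> by (auto simp: total_deg_def)
    then obtain i where i: "i \<in> Poly_Mapping.keys \<mu>" by blast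
    have "hom_fun I v (\<lambda>x. Poly_Mapping.lookup f \<mu> * mono_eval x \<mu>)"
      unfolding hom_fun_def
      by (rule bexI[of _ "Poly_Mapping.single \<mu> (Poly_Mapping.lookup f \<mu>)"])
        (use deg in \<open>auto simp: hom_polys_iff fun_eq_iff\<close>)
    then have "hom_fun I (v + (CARD('a) - 1))
        (\<lambda>x. Poly_Mapping.lookup f \<mu> * mono_eval x \<mu> * x i ^ (CARD('a) - 1))"
      by (rule hom_fun_mult) (use i deg in \<open>auto intro: hom_fun_coord_power\<close>)
    moreover have "mono_eval x \<mu> * x i ^ (CARD('a) - 1) = mono_eval x \<mu>" for x :: "nat \<Rightarrow> 'a"
    proof (cases "x i = 0")
      case True
      then have "mono_eval x \<mu> = 0"
        using i by (auto simp: mono_eval_def in_keys_iff intro!: prod_zero)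
      then show ?thesis by simp
    qed (simp add: power_card_minus_1 del: One_nat_def)
    ultimately show ?thesis by (simp only: mult.assoc)
  qed
  then have "hom_fun I (v + (CARD('a) - 1))
      (\<lambda>x. \<Sum>\<mu>\<in>Poly_Mapping.keys f. Poly_Mapping.lookup f \<mu> * mono_eval x \<mu>)"
    by (rule hom_fun_sum)
  then show ?thesis
    by (simp add: f(2) mv_eval_eq[abs_def])
qed

section \<open>Binary forms as functions\<close>

text \<open>The values of a binary form on the whole plane, origin included. The coefficients are
  existential because only values matter.\<close>

definition binary_form :: "nat \<Rightarrow> ('a::field \<Rightarrow> 'a \<Rightarrow> 'a) \<Rightarrow> bool" where
  "binary_form k \<phi> \<longleftrightarrow> (\<exists>c. \<forall>s t. \<phi> s t = (\<Sum>i\<le>k. c i * s ^ (k - i) * t ^ i))"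

lemma binary_form_0: "binary_form k (\<lambda>s t. 0)"
  unfolding binary_form_def by (rule exI[of _ "\<lambda>i. 0"]) simp

lemma binary_form_add:
  assumes "binary_form k \<phi>" "binary_form k \<psi>"
  shows "binary_form k (\<lambda>s t. \<phi> s t + \<psi> s t)"
proof -
  from assms obtain c d where
    "\<And>s t. \<phi> s t = (\<Sum>i\<le>k. c i * s ^ (k - i) * t ^ i)"
    "\<And>s t. \<psi> s t = (\<Sum>i\<le>k. d i * s ^ (k - i) * t ^ i)"
    unfolding binary_form_def by blast
  then show ?thesis
    unfolding binary_form_def
    by (intro exI[of _ "\<lambda>i. c i + d i"]) (simp add: sum.distrib algebra_simps)
qed

lemma binary_form_cmult:
  assumes "binary_form k \<phi>"
  shows "binary_form k (\<lambda>s t. a * \<phi> s t)"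
proof -
  from assms obtain c where "\<And>s t. \<phi> s t = (\<Sum>i\<le>k. c i * s ^ (k - i) * t ^ i)"
    unfolding binary_form_def by blast
  then show ?thesis
    unfolding binary_form_def
    by (intro exI[of _ "\<lambda>i. a * c i"]) (simp add: sum_distrib_left algebra_simps)
qed

lemma binary_form_sum:
  "(\<And>j. j \<in> A \<Longrightarrow> binary_form k (\<phi> j)) \<Longrightarrow> binary_form k (\<lambda>s t. \<Sum>j\<in>A. \<phi> j s t)"
  by (induction A rule: infinite_finite_induct) (auto intro: binary_form_0 binary_form_add)

lemma binary_form_mult_fst:
  assumes "binary_form k \<phi>"
  shows "binary_form (Suc k) (\<lambda>s t. s * \<phi> s t)"
proof -
  from assms obtain c where c: "\<And>s t. \<phi> s t = (\<Sum>i\<le>k. c i * s ^ (k - i) * t ^ i)"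
    unfolding binary_form_def by blast
  have "s * \<phi> s t = (\<Sum>i\<le>Suc k. (if i \<le> k then c i else 0) * s ^ (Suc k - i) * t ^ i)" for s t
    by (simp add: c sum_distrib_left Suc_diff_le algebra_simps)
  then show ?thesis
    unfolding binary_form_def by (intro exI[of _ "\<lambda>i. if i \<le> k then c i else 0"] allI)
qed

lemma binary_form_mult_snd:
  assumes "binary_form k \<phi>"
  shows "binary_form (Suc k) (\<lambda>s t. t * \<phi> s t)"
proof -
  from assms obtain c where c: "\<And>s t. \<phi> s t = (\<Sum>i\<le>k. c i * s ^ (k - i) * t ^ i)"
    unfolding binary_form_def by blast
  have "t * \<phi> s t = (\<Sum>i\<le>Suc k. (if i = 0 then 0 else c (i - 1)) * s ^ (Suc k - i) * t ^ i)" for s t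
    by (subst sum.atMost_Suc_shift) (simp add: c sum_distrib_left algebra_simps)
  then show ?thesis
    unfolding binary_form_def by (intro exI[of _ "\<lambda>i. if i = 0 then 0 else c (i - 1)"] allI)
qed

lemma binary_form_mult_linear:
  assumes "binary_form k \<phi>"
  shows "binary_form (Suc k) (\<lambda>s t. (a * s + b * t) * \<phi> s t)"
  using binary_form_add[OF binary_form_cmult[OF binary_form_mult_fst[OF assms], of a]
      binary_form_cmult[OF binary_form_mult_snd[OF assms], of b]]
  by (simp add: algebra_simps)

lemma binary_form_const: "binary_form 0 (\<lambda>s t. c)"
  unfolding binary_form_def by (rule exI[of _ "\<lambda>i. c"]) simp

lemma binary_form_linear_power_mult:
  "binary_form k \<phi> \<Longrightarrow> binary_form (n + k) (\<lambda>s t. (a * s + b * t) ^ n * \<phi> s t)"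
  by (induction n) (simp_all add: mult.assoc binary_form_mult_linear)

lemma binary_form_linear_power: "binary_form n (\<lambda>s t. (a * s + b * t) ^ n)"
  using binary_form_linear_power_mult[OF binary_form_const[of 1], of n a b] by simp

text \<open>Each monomial becomes a product of powers of two linear forms, built up one linear
  factor at a time.\<close>

lemma binary_form_subst:
  assumes "binary_form k \<phi>"
  shows "binary_form k (\<lambda>s t. \<phi> (a * s + b * t) (c * s + d * t))"
proof -
  from assms obtain e where e: "\<And>s t. \<phi> s t = (\<Sum>i\<le>k. e i * s ^ (k - i) * t ^ i)"
    unfolding binary_form_def by blast
  have "binary_form k (\<lambda>s t. e i * ((a * s + b * t) ^ (k - i) * (c * s + d * t) ^ i))"
    if "i \<le> k" for i
    using binary_form_linear_power_mult[OF binary_form_linear_power[of i c d], of "k - i" a b] that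
    by (intro binary_form_cmult) simp
  then have "binary_form k (\<lambda>s t. \<Sum>i\<le>k. e i * ((a * s + b * t) ^ (k - i) * (c * s + d * t) ^ i))"
    by (intro binary_form_sum) auto
  then show ?thesis
    by (simp add: e mult.assoc)
qed

lemma binary_form_imp_hom_fun:
  assumes "binary_form k \<phi>" and "a \<in> I" "b \<in> I"
  shows "hom_fun I k (\<lambda>x. \<phi> (x a) (x b))"
proof -
  from assms obtain c where c: "\<And>s t. \<phi> s t = (\<Sum>i\<le>k. c i * s ^ (k - i) * t ^ i)"
    unfolding binary_form_def by blast
  have "hom_fun I k (\<lambda>x. c i * (x a ^ (k - i) * x b ^ i))" if "i \<le> k" for i
    using hom_fun_mult[OF hom_fun_coord_power[OF assms(2), of "k - i"] hom_fun_coord_power[OF assms(3), of i]] that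
    by (intro hom_fun_cmult) simp
  then have "hom_fun I k (\<lambda>x. \<Sum>i\<le>k. c i * (x a ^ (k - i) * x b ^ i))"
    by (intro hom_fun_sum) auto
  then show ?thesis
    by (simp add: c mult.assoc)
qed

lemma hom_polys_imp_binary_form:
  assumes "f \<in> hom_polys {0..1} k"
  shows "binary_form k (\<lambda>s t. mv_eval f ((\<lambda>i. 0)(0 := s, 1 := t)))"
proof -
  have "binary_form k (\<lambda>s t. Poly_Mapping.lookup f \<mu> * mono_eval ((\<lambda>i. 0)(0 := s, 1 := t)) \<mu>)"
    if "\<mu> \<in> Poly_Mapping.keys f" for \<mu>
  proof -
    let ?e = "Poly_Mapping.lookup \<mu>"
    have \<mu>: "Poly_Mapping.keys \<mu> \<subseteq> {0, 1}" "total_deg \<mu> = k"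
      using assms that by (auto simp: hom_polys_iff atLeastAtMost_upt)
    have "total_deg \<mu> = (\<Sum>i\<in>{0, 1}. ?e i)"
      unfolding total_deg_def by (rule sum.mono_neutral_left) (use \<mu>(1) in \<open>auto simp: in_keys_iff\<close>)
    then have k: "k = ?e 0 + ?e 1"
      using \<mu>(2) by simp
    have "mono_eval ((\<lambda>i. 0)(0 := s, 1 := t)) \<mu> = s ^ ?e 0 * t ^ ?e 1" for s t :: 'a
      by (subst mono_eval_superset[OF _ \<mu>(1)]) simp_all
    \<comment> \<open>The two coordinates are the linear forms with coefficients
      \<open>(1, 0)\<close> and \<open>(0, 1)\<close>.\<close>
    then show ?thesis
      using binary_form_cmult[OF binary_form_linear_power_mult[OF binary_form_linear_power[of "?e 1" 0 1], of "?e 0" 1 0]]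
      by (simp add: k)
  qed
  then show ?thesis
    unfolding mv_eval_eq by (rule binary_form_sum)
qed

lemma binary_form_scale:
  assumes "binary_form k \<phi>"
  shows "\<phi> (c * s) (c * t) = c ^ k * \<phi> s t"
proof -
  from assms obtain e where e: "\<And>s t. \<phi> s t = (\<Sum>i\<le>k. e i * s ^ (k - i) * t ^ i)"
    unfolding binary_form_def by blast
  have "(c * s) ^ (k - i) * (c * t) ^ i = c ^ k * (s ^ (k - i) * t ^ i)" if "i \<le> k" for i
  proof -
    have "c ^ k = c ^ (k - i) * c ^ i" using that by (simp flip: power_add)
    then show ?thesis by (simp add: power_mult_distrib algebra_simps)
  qed
  then show ?thesis
    by (auto simp: e sum_distrib_left mult.assoc mult.left_commute intro!: sum.cong)
qed


section \<open>Cone and chart\<close>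

text \<open>Words of lifted projective codes, extended from standard representatives to the whole
  space. Admitting dependent \<open>u\<close>, \<open>w\<close> builds in homogeneity of degree
  \<open>k\<close>.\<close>

definition planar_forms :: "nat set \<Rightarrow> nat \<Rightarrow> ((nat \<Rightarrow> 'a::field) \<Rightarrow> 'a) set" where
  "planar_forms I k = {F. (\<forall>x. x \<notin> vecs I \<longrightarrow> F x = 0) \<and>
     (\<forall>u\<in>vecs I. \<forall>w\<in>vecs I. binary_form k (\<lambda>s t. F (\<lambda>i. s * u i + t * w i)))}"

text \<open>The strict bound \<open>i < k\<close> is the degree bound \<open>k - 1\<close> of the
  affine code.\<close>

definition line_polys :: "nat set \<Rightarrow> nat \<Rightarrow> ((nat \<Rightarrow> 'a::field) \<Rightarrow> 'a) set" where
  "line_polys J k = {h. (\<forall>x. x \<notin> vecs J \<longrightarrow> h x = 0) \<and>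
     (\<forall>u\<in>vecs J. \<forall>w\<in>vecs J. \<exists>c. \<forall>t. h (\<lambda>i. u i + t * w i) = (\<Sum>i<k. c i * t ^ i))}"

text \<open>The pullback of \<open>G\<close> along the projection that forgets coordinate
  \<open>a\<close>.\<close>

definition cone :: "nat \<Rightarrow> nat set \<Rightarrow> ((nat \<Rightarrow> 'a::field) \<Rightarrow> 'a) \<Rightarrow> (nat \<Rightarrow> 'a) \<Rightarrow> 'a" where
  "cone a I G x = (if x \<in> vecs I then G (x(a := 0)) else 0)"

text \<open>On the hyperplane \<open>x a = 0\<close> the quotients take the default value
  \<open>0\<close>; for \<open>k \<ge> 1\<close> the factor \<open>x a ^ k\<close> makes the whole
  expression vanish there.\<close>

definition homogenize :: "nat \<Rightarrow> nat set \<Rightarrow> nat \<Rightarrow> ((nat \<Rightarrow> 'a::field) \<Rightarrow> 'a) \<Rightarrow> (nat \<Rightarrow> 'a) \<Rightarrow> 'a" where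
  "homogenize a I k h x =
     (if x \<in> vecs I then x a ^ k * h ((\<lambda>i. x i / x a)(a := 0)) else 0)"

section \<open>Elementary closure properties of the two function spaces\<close>

lemma vecs_lin_comb: "u \<in> vecs I \<Longrightarrow> w \<in> vecs I \<Longrightarrow> (\<lambda>i. s * u i + t * w i :: 'a::field) \<in> vecs I"
  by (simp add: vecs_def)

lemma planar_formsD:
  "F \<in> planar_forms I k \<Longrightarrow> u \<in> vecs I \<Longrightarrow> w \<in> vecs I \<Longrightarrow>
    binary_form k (\<lambda>s t. F (\<lambda>i. s * u i + t * w i))"
  by (auto simp: planar_forms_def)

lemma planar_forms_outside: "F \<in> planar_forms I k \<Longrightarrow> x \<notin> vecs I \<Longrightarrow> F x = 0"
  by (auto simp: planar_forms_def)

lemma line_polys_outside: "h \<in> line_polys I k \<Longrightarrow> x \<notin> vecs I \<Longrightarrow> h x = 0"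
  by (auto simp: line_polys_def)

lemma planar_forms_scale:
  assumes "F \<in> planar_forms I k" "x \<in> vecs I"
  shows "F (\<lambda>i. c * x i) = c ^ k * F x"
  using binary_form_scale[OF planar_formsD[OF assms assms(2)], of c 1 0] by simp

lemma planar_forms_lin_comb:
  assumes "F \<in> planar_forms I k" "G \<in> planar_forms I k"
  shows "(\<lambda>x. F x + c * G x) \<in> planar_forms I k"
  using assms unfolding planar_forms_def
  by (auto intro!: binary_form_add binary_form_cmult)

lemma line_polys_lin_comb:
  assumes "h \<in> line_polys J k" "g \<in> line_polys J k"
  shows "(\<lambda>x. h x + c * g x) \<in> line_polys J k"
  unfolding line_polys_def
proof (intro CollectI conjI ballI allI impI)
  fix u w :: "nat \<Rightarrow> 'a"
  assume "u \<in> vecs J" "w \<in> vecs J"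
  then obtain p q where "\<And>t. h (\<lambda>i. u i + t * w i) = (\<Sum>i<k. p i * t ^ i)"
    "\<And>t. g (\<lambda>i. u i + t * w i) = (\<Sum>i<k. q i * t ^ i)"
    using assms unfolding line_polys_def by blast
  then show "\<exists>d. \<forall>t. h (\<lambda>i. u i + t * w i) + c * g (\<lambda>i. u i + t * w i) = (\<Sum>i<k. d i * t ^ i)"
    by (intro exI[of _ "\<lambda>i. p i + c * q i"])
      (simp add: sum.distrib sum_distrib_left algebra_simps)
qed (use assms in \<open>auto simp: line_polys_def\<close>)

section \<open>Passing between the cone, the chart and the hyperplane at infinity\<close>

lemma cone_in_planar_forms:
  assumes "G \<in> planar_forms J k"
  shows "cone a (insert a J) G \<in> planar_forms (insert a J) k"
  unfolding planar_forms_def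
proof (intro CollectI conjI ballI allI impI)
  fix u w :: "nat \<Rightarrow> 'a"
  assume uw: "u \<in> vecs (insert a J)" "w \<in> vecs (insert a J)"
  then have "u(a := 0) \<in> vecs J" "w(a := 0) \<in> vecs J"
    by (auto simp: vecs_def)
  from planar_formsD[OF assms this]
  have "binary_form k (\<lambda>s t. G ((\<lambda>i. s * u i + t * w i)(a := 0)))"
    by (rule back_subst[of "binary_form k"]) (auto simp: fun_eq_iff intro!: arg_cong[of _ _ G])
  then show "binary_form k (\<lambda>s t. cone a (insert a J) G (\<lambda>i. s * u i + t * w i))"
    using vecs_lin_comb[OF uw] by (simp add: cone_def)
qed (simp add: cone_def)

text \<open>A plane not contained in \<open>x a = 0\<close> meets the chart in a line, possibly
  degenerate. Along it \<open>h\<close> has degree below \<open>k\<close>, so the factor of degree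
  \<open>k\<close> clears the denominators and leaves a binary form. Planes inside the hyperplane
  give zero.\<close>

lemma homogenize_in_planar_forms:
  fixes h :: "(nat \<Rightarrow> 'a::field) \<Rightarrow> 'a"
  assumes h: "h \<in> line_polys J k" and "a \<notin> J" and "k \<ge> 1"
  shows "homogenize a (insert a J) k h \<in> planar_forms (insert a J) k" (is "?H \<in> planar_forms ?I k")
proof -
  have main: "binary_form k (\<lambda>s t. ?H (\<lambda>i. s * u i + t * w i))"
    if uw: "u \<in> vecs ?I" "w \<in> vecs ?I" and ua: "u a \<noteq> 0" for u w
  proof -
    \<comment> \<open>Subtracting \<open>b\<close> times \<open>u\<close> moves \<open>w\<close>
      into the hyperplane. Then \<open>s u + t w = (s + b t) u + t (w - b u)\<close>, and dividing
      by coordinate \<open>a\<close> gives the chart point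
      \<open>u' + t / (s + b t) w'\<close>.\<close>
    define b where "b = w a / u a"
    define u' where "u' = (\<lambda>i. u i / u a)(a := 0)"
    define w' where "w' = (\<lambda>i. (w i - b * u i) / u a)(a := 0)"
    have "u' \<in> vecs J" "w' \<in> vecs J"
      using uw by (auto simp: u'_def w'_def vecs_def)
    then obtain c where c: "\<And>t. h (\<lambda>i. u' i + t * w' i) = (\<Sum>i<k. c i * t ^ i)"
      using h unfolding line_polys_def by blast
    have "?H (\<lambda>i. s * u i + t * w i) = (\<Sum>i<k. u a ^ k * c i * ((s + b * t) ^ (k - i) * t ^ i))" for s t
    proof (cases "s + b * t = 0")
      case True
      \<comment> \<open>The left side vanishes through \<open>x a ^ k\<close>, the right side
        because every \<open>k - i\<close> is positive.\<close>
      then have "s * u a + t * w a = 0"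
        using ua by (auto simp: b_def field_simps)
      then show ?thesis
        using True \<open>k \<ge> 1\<close> by (auto simp: homogenize_def power_0_left)
    next
      case False
      have a: "s * u a + t * w a = (s + b * t) * u a"
        using ua by (simp add: b_def field_simps)
      have "(\<lambda>i. (s * u i + t * w i) / (s * u a + t * w a))(a := 0) = (\<lambda>i. u' i + t / (s + b * t) * w' i)"
        unfolding a using False ua by (auto simp: u'_def w'_def fun_eq_iff divide_simps) (simp add: algebra_simps)
      then have "?H (\<lambda>i. s * u i + t * w i)
          = ((s + b * t) * u a) ^ k * (\<Sum>i<k. c i * (t / (s + b * t)) ^ i)"
        using vecs_lin_comb[OF uw] by (simp add: homogenize_def c a del: times_divide_eq_left times_divide_eq_right)
      also have "\<dots> = (\<Sum>i<k. u a ^ k * c i * ((s + b * t) ^ (k - i) * t ^ i))"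
        unfolding sum_distrib_left
      proof (rule sum.cong)
        fix i assume "i \<in> {..<k}"
        then have "(s + b * t) ^ k = (s + b * t) ^ (k - i) * (s + b * t) ^ i"
          by (simp flip: power_add)
        then show "((s + b * t) * u a) ^ k * (c i * (t / (s + b * t)) ^ i)
            = u a ^ k * c i * ((s + b * t) ^ (k - i) * t ^ i)"
          using False by (simp add: power_mult_distrib power_divide)
      qed simp
      finally show ?thesis .
    qed
    moreover have "binary_form k (\<lambda>s t. (s + b * t) ^ (k - i) * t ^ i)" if "i < k" for i
      using binary_form_linear_power_mult[OF binary_form_linear_power[of i 0 1], of "k - i" 1 b] that by simp
    then have "binary_form k (\<lambda>s t. \<Sum>i<k. u a ^ k * c i * ((s + b * t) ^ (k - i) * t ^ i))"
      by (intro binary_form_sum binary_form_cmult) auto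
    ultimately show ?thesis by simp
  qed
  have "binary_form k (\<lambda>s t. ?H (\<lambda>i. s * u i + t * w i))"
    if uw: "u \<in> vecs ?I" "w \<in> vecs ?I" for u w
  proof (cases "u a = 0 \<and> w a = 0")
    case True
    then have "?H (\<lambda>i. s * u i + t * w i) = 0" for s t
      using \<open>k \<ge> 1\<close> by (simp add: homogenize_def power_0_left)
    then show ?thesis by (simp add: binary_form_0)
  next
    case False
    then consider "u a \<noteq> 0" | "w a \<noteq> 0" by blast
    then show ?thesis
    proof cases
      \<comment> \<open>Exchange the roles of \<open>u\<close> and \<open>w\<close>, and those of
        \<open>s\<close> and \<open>t\<close>.\<close>
      case 2
      from binary_form_subst[OF main[OF uw(2,1) 2], of 0 1 1 0]
      show ?thesis by (simp add: add.commute)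
    qed (rule main[OF uw])
  qed
  then show ?thesis
    by (simp add: planar_forms_def homogenize_def)
qed

text \<open>Setting \<open>s = 1\<close> in the binary form of a plane gives degree at most
  \<open>k\<close> in \<open>t\<close>. The coefficient of \<open>t ^ k\<close> is the value at
  infinity \<open>F w\<close>, which is zero by assumption.\<close>

lemma chart_in_line_polys:
  fixes F :: "(nat \<Rightarrow> 'a::field) \<Rightarrow> 'a"
  assumes F: "F \<in> planar_forms (insert a J) k" and "a \<notin> J"
    and vanish: "\<And>x. x \<in> vecs J \<Longrightarrow> F x = 0"
  shows "(\<lambda>x. if x \<in> vecs J then F (x(a := 1)) else 0) \<in> line_polys J k" (is "?h \<in> _")
  unfolding line_polys_def
proof (intro CollectI conjI ballI allI impI)
  fix u w :: "nat \<Rightarrow> 'a"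
  assume uw: "u \<in> vecs J" "w \<in> vecs J"
  then have "u(a := 1) \<in> vecs (insert a J)" "w \<in> vecs (insert a J)"
    by (auto simp: vecs_def)
  from planar_formsD[OF F this] obtain c where
    c: "\<And>s t. F (\<lambda>i. s * (u(a := 1)) i + t * w i) = (\<Sum>i\<le>k. c i * s ^ (k - i) * t ^ i)"
    unfolding binary_form_def by blast
  have "(\<Sum>i\<le>k. c i * 0 ^ (k - i) * 1 ^ i) = (\<Sum>i\<le>k. if i = k then c k else 0)"
    by (rule sum.cong) (auto simp: power_0_left)
  then have "c k = 0"
    using c[of 0 1] vanish[OF uw(2)] by simp
  then have sum: "(\<Sum>i\<le>k. c i * t ^ i) = (\<Sum>i<k. c i * t ^ i)" for t
    by (simp flip: lessThan_Suc_atMost)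
  have "?h (\<lambda>i. u i + t * w i) = (\<Sum>i<k. c i * t ^ i)" for t
  proof -
    have "(\<lambda>i. u i + t * w i) \<in> vecs J"
      using vecs_lin_comb[OF uw, of 1 t] by simp
    moreover have "w a = 0"
      using uw \<open>a \<notin> J\<close> by (simp add: vecs_def)
    then have "(\<lambda>i. u i + t * w i)(a := 1) = (\<lambda>i. 1 * (u(a := 1)) i + t * w i)"
      by (auto simp: fun_eq_iff)
    ultimately show ?thesis
      using c[of 1 t] sum[of t] by (simp del: fun_upd_apply)
  qed
  then show "\<exists>c. \<forall>t. ?h (\<lambda>i. u i + t * w i) = (\<Sum>i<k. c i * t ^ i)"
    by blast
qed simp

lemma planar_forms_restrict:
  assumes F: "F \<in> planar_forms I k" and "J \<subseteq> I"
  shows "(\<lambda>x. if x \<in> vecs J then F x else 0) \<in> planar_forms J k"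
  unfolding planar_forms_def
proof (intro CollectI conjI ballI allI impI)
  fix u w :: "nat \<Rightarrow> 'a"
  assume uw: "u \<in> vecs J" "w \<in> vecs J"
  with \<open>J \<subseteq> I\<close> have "u \<in> vecs I" "w \<in> vecs I" by (auto simp: vecs_def)
  from planar_formsD[OF F this] vecs_lin_comb[OF uw]
  show "binary_form k (\<lambda>s t. if (\<lambda>i. s * u i + t * w i) \<in> vecs J then F (\<lambda>i. s * u i + t * w i) else 0)"
    by simp
qed simp

section \<open>Splitting off one coordinate\<close>

lemma cone_plus_homogenize_restrict:
  assumes "a \<notin> J" "x \<in> vecs J" "k \<ge> 1"
  shows "cone a (insert a J) G x + homogenize a (insert a J) k h x = G x"
proof -
  have "x \<in> vecs (insert a J)" "x(a := 0) = x" "x a = 0"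
    using assms by (auto simp: vecs_def fun_eq_iff)
  then show ?thesis
    using \<open>k \<ge> 1\<close> by (simp add: cone_def homogenize_def power_0_left)
qed

lemma cone_plus_homogenize_chart:
  assumes "a \<notin> J" "x \<in> vecs J"
  shows "cone a (insert a J) G (x(a := 1)) + homogenize a (insert a J) k h (x(a := 1)) = G x + h x"
proof -
  have "x(a := 1) \<in> vecs (insert a J)" "x(a := 0) = x"
    using assms by (auto simp: vecs_def fun_eq_iff)
  moreover have "(\<lambda>i. (x(a := 1)) i / (x(a := 1)) a)(a := 0) = x(a := 0)"
    by (auto simp: fun_eq_iff)
  ultimately show ?thesis
    by (simp add: cone_def homogenize_def del: fun_upd_apply) simp
qed

lemma planar_forms_decompose:
  fixes F :: "(nat \<Rightarrow> 'a::field) \<Rightarrow> 'a"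
  assumes F: "F \<in> planar_forms (insert a J) k" and a: "a \<notin> J" and k: "k \<ge> 1"
  obtains G h where "G \<in> planar_forms J k" "h \<in> line_polys J k"
    "F = (\<lambda>x. cone a (insert a J) G x + homogenize a (insert a J) k h x)"
proof -
  let ?I = "insert a J"
  define G where "G = (\<lambda>x. if x \<in> vecs J then F x else 0)"
  \<comment> \<open>Subtracting the cone yields a form that vanishes on \<open>x a = 0\<close>, so
    its restriction to the chart has degree below \<open>k\<close> on lines.\<close>
  define F' where "F' = (\<lambda>x. F x + (- 1) * cone a ?I G x)"
  define h where "h = (\<lambda>x. if x \<in> vecs J then F' (x(a := 1)) else 0)"
  have G: "G \<in> planar_forms J k"
    unfolding G_def by (rule planar_forms_restrict[OF F]) auto
  have F': "F' \<in> planar_forms ?I k"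
    unfolding F'_def by (rule planar_forms_lin_comb[OF F cone_in_planar_forms[OF G]])
  have vanish: "F' x = 0" if "x \<in> vecs J" for x
    \<comment> \<open>The zero function in place of \<open>h\<close> contributes nothing, so only
      the restriction of the cone remains.\<close>
    using cone_plus_homogenize_restrict[OF a that k, of G "\<lambda>x. 0"] that
    by (simp add: F'_def G_def homogenize_def split: if_splits)
  have h: "h \<in> line_polys J k"
    unfolding h_def by (rule chart_in_line_polys[OF F' a vanish])
  have "F' x = homogenize a ?I k h x" for x
  proof (cases "x \<in> vecs ?I")
    case x: True
    show ?thesis
    proof (cases "x a = 0")
      case True
      with x have "x \<in> vecs J" by (auto simp: vecs_def)
      then show ?thesis
        using True k by (simp add: vanish homogenize_def power_0_left)
    next
      case False
      let ?y = "(\<lambda>i. x i / x a)(a := 0)"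
      have y: "?y \<in> vecs J" using x by (auto simp: vecs_def)
      have y1: "?y(a := 1) \<in> vecs ?I" using x by (auto simp: vecs_def)
      \<comment> \<open>Off the hyperplane, \<open>x\<close> is \<open>x a\<close> times a point of
        the chart, and homogeneity of degree \<open>k\<close> determines the value.\<close>
      have "x = (\<lambda>i. x a * (?y(a := 1)) i)"
        using False by (auto simp: fun_eq_iff)
      then have "F' x = x a ^ k * F' (?y(a := 1))"
        using planar_forms_scale[OF F' y1, of "x a"] by simp
      then show ?thesis
        using x y by (simp add: homogenize_def h_def)
    qed
  qed (use planar_forms_outside[OF F'] in \<open>simp add: homogenize_def\<close>)
  then have "F = (\<lambda>x. cone a ?I G x + homogenize a ?I k h x)"
    by (auto simp: F'_def fun_eq_iff algebra_simps)
  with G h show thesis by (rule that)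
qed

text \<open>The pair can be read off from the function: on \<open>vecs J\<close> its values are
  those of \<open>G\<close>, and at \<open>x a = 1\<close> those of \<open>G + h\<close>.\<close>

lemma card_planar_forms_insert:
  assumes a: "a \<notin> J" and k: "k \<ge> 1"
  shows "card (planar_forms (insert a J) k :: ((nat \<Rightarrow> 'a::field) \<Rightarrow> 'a) set) =
    card (planar_forms J k :: ((nat \<Rightarrow> 'a) \<Rightarrow> 'a) set) * card (line_polys J k :: ((nat \<Rightarrow> 'a) \<Rightarrow> 'a) set)"
proof -
  let ?\<Phi> = "\<lambda>(G, h) x. cone a (insert a J) G x + homogenize a (insert a J) k h x :: 'a"
  let ?A = "planar_forms J k \<times> line_polys J k :: (((nat \<Rightarrow> 'a) \<Rightarrow> 'a) \<times> ((nat \<Rightarrow> 'a) \<Rightarrow> 'a)) set"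
  have "inj_on ?\<Phi> ?A"
  proof (rule inj_onI, clarify)
    fix G h G' h' :: "(nat \<Rightarrow> 'a) \<Rightarrow> 'a"
    assume G: "G \<in> planar_forms J k" "G' \<in> planar_forms J k"
      and h: "h \<in> line_polys J k" "h' \<in> line_polys J k"
      and eq: "(\<lambda>x. cone a (insert a J) G x + homogenize a (insert a J) k h x) =
        (\<lambda>x. cone a (insert a J) G' x + homogenize a (insert a J) k h' x)"
    have GG': "G x = G' x" if "x \<in> vecs J" for x
      using fun_cong[OF eq, of x] unfolding cone_plus_homogenize_restrict[OF a that k] .
    moreover have "h x = h' x" if "x \<in> vecs J" for x
      using fun_cong[OF eq, of "x(a := 1)"] GG'[OF that]
      unfolding cone_plus_homogenize_chart[OF a that] by simp
    ultimately have "G x = G' x" "h x = h' x" for x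
      using planar_forms_outside[OF G(1), of x] planar_forms_outside[OF G(2), of x]
        line_polys_outside[OF h(1), of x] line_polys_outside[OF h(2), of x]
      by (cases "x \<in> vecs J"; simp)+
    then show "G = G' \<and> h = h'"
      by (simp add: fun_eq_iff)
  qed
  moreover have "?\<Phi> ` ?A = planar_forms (insert a J) k"
  proof (intro equalityI subsetI)
    fix F assume "F \<in> ?\<Phi> ` ?A"
    then obtain G h where "G \<in> planar_forms J k" "h \<in> line_polys J k"
      "F = (\<lambda>x. cone a (insert a J) G x + 1 * homogenize a (insert a J) k h x)"
      by auto
    then show "F \<in> planar_forms (insert a J) k"
      using planar_forms_lin_comb[OF cone_in_planar_forms homogenize_in_planar_forms[OF _ a k]] by blast
  next
    fix F :: "(nat \<Rightarrow> 'a) \<Rightarrow> 'a"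
    assume "F \<in> planar_forms (insert a J) k"
    then show "F \<in> ?\<Phi> ` ?A"
      by (elim planar_forms_decompose[OF _ a k]) force
  qed
  ultimately show ?thesis
    using card_image[of ?\<Phi> ?A] by (simp only: card_cartesian_product)
qed

section \<open>Planar forms are homogeneous polynomials\<close>

text \<open>Coordinate \<open>b\<close> stays a polynomial variable of degree below
  \<open>k\<close>. Only the coordinates in \<open>J\<close> are interpolated, each at the cost of
  \<open>q - 1\<close> in the degree.\<close>

lemma homogenize_eq_hom_fun:
  fixes h :: "(nat \<Rightarrow> 'a::{field,finite}) \<Rightarrow> 'a"
  assumes h: "h \<in> line_polys (insert b J) k" and J: "finite J" "b \<notin> J"
    and a: "a \<notin> insert b J" and k: "k \<ge> 1"
  obtains \<phi> where "hom_fun (insert a (insert b J)) (k + card J * (CARD('a) - 1)) \<phi>"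
    "\<And>x. x \<in> vecs (insert a (insert b J)) \<Longrightarrow> \<phi> x = homogenize a (insert a (insert b J)) k h x"
proof -
  let ?I = "insert a (insert b J)" and ?q1 = "CARD('a) - 1"
  define e :: "nat \<Rightarrow> 'a" where "e = (\<lambda>i. 0)(b := 1)"
  have "\<exists>c. \<forall>t. h (\<lambda>i. y i + t * e i) = (\<Sum>j<k. c j * t ^ j)" if "y \<in> vecs J" for y
  proof -
    have "y \<in> vecs (insert b J)" "e \<in> vecs (insert b J)"
      using that by (auto simp: vecs_def e_def)
    then show ?thesis using h unfolding line_polys_def by blast
  qed
  then obtain c where c: "\<And>y t. y \<in> vecs J \<Longrightarrow> h (\<lambda>i. y i + t * e i) = (\<Sum>j<k. c y j * t ^ j)"
    by metis
  \<comment> \<open>Where \<open>x a \<noteq> 0\<close>, the product over \<open>J\<close> is the indicator of \<open>x i / x a = y i\<close> for all \<open>i \<in> J\<close>.\<close>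
  define \<delta> :: "(nat \<Rightarrow> 'a) \<Rightarrow> (nat \<Rightarrow> 'a) \<Rightarrow> 'a" where "\<delta> = (\<lambda>y x. \<Prod>i\<in>J. x a ^ ?q1 - (x i - y i * x a) ^ ?q1)"
  \<comment> \<open>The \<open>c y j\<close> are the coefficients of \<open>h\<close> on the line
    through \<open>y\<close> in direction \<open>b\<close>. The exponents of \<open>x b\<close> and
    \<open>x a\<close> add up to \<open>k\<close>, so all terms have the same degree.\<close>
  define \<phi> where "\<phi> = (\<lambda>x. \<Sum>y\<in>vecs J. \<Sum>j<k. c y j * (x b ^ j * x a ^ (k - j) * \<delta> y x))"
  have \<delta>: "hom_fun ?I (card J * ?q1) (\<delta> y)" for y
  proof -
    have "hom_fun ?I ?q1 (\<lambda>x. x a ^ ?q1 - (x i - y i * x a) ^ ?q1)" if "i \<in> J" for i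
    proof -
      have "hom_fun ?I 1 (\<lambda>x. x i - y i * x a)"
        using that by (intro hom_fun_diff hom_fun_cmult hom_fun_coord) auto
      from hom_fun_power[OF this, of ?q1]
      have "hom_fun ?I ?q1 (\<lambda>x. (x i - y i * x a) ^ ?q1)" by simp
      then show ?thesis
        by (intro hom_fun_diff hom_fun_coord_power) auto
    qed
    then show ?thesis
      unfolding \<delta>_def by (rule hom_fun_prod[OF J(1)])
  qed
  have "hom_fun ?I (k + card J * ?q1) (\<lambda>x. x b ^ j * x a ^ (k - j) * \<delta> y x)" if "j < k" for j y
  proof -
    have "hom_fun ?I (j + (k - j)) (\<lambda>x. x b ^ j * x a ^ (k - j))"
      by (intro hom_fun_mult hom_fun_coord_power) auto
    from hom_fun_mult[OF this \<delta>] that show ?thesis by simp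
  qed
  then have "hom_fun ?I (k + card J * ?q1) \<phi>"
    unfolding \<phi>_def by (intro hom_fun_sum hom_fun_cmult) auto
  moreover have "\<phi> x = homogenize a ?I k h x" if x: "x \<in> vecs ?I" for x
  proof (cases "x a = 0")
    case True
    \<comment> \<open>Every summand contains \<open>x a ^ (k - j)\<close> with \<open>k - j\<close>
      positive.\<close>
    then show ?thesis
      using k by (auto simp: \<phi>_def homogenize_def power_0_left intro!: sum.neutral)
  next
    case False
    define z where "z = (\<lambda>i. x i / x a)(a := 0)"
    define y where "y = z(b := 0)"
    have y: "y \<in> vecs J"
      using x by (auto simp: vecs_def y_def z_def)
    have "\<delta> y' x = (if y' = y then 1 else 0)" if y': "y' \<in> vecs J" for y'
    proof (cases "y' = y")
      case True
      have "x i - y i * x a = 0" if "i \<in> J" for i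
        using that J a False by (auto simp: y_def z_def)
      then have "\<delta> y x = (\<Prod>i\<in>J. 1)"
        unfolding \<delta>_def using power_card_minus_1[OF False] CARD_finite_field_ge_2[where 'a='a]
        by (intro prod.cong) (auto simp: power_0_left simp del: One_nat_def)
      then show ?thesis using True by simp
    next
      case neq: False
      then obtain i where i: "y' i \<noteq> y i" by auto
      with y y' have "i \<in> J" by (fastforce simp: vecs_def)
      moreover have "x i - y' i * x a \<noteq> 0"
      proof -
        have "y i = x i / x a"
          using \<open>i \<in> J\<close> J a by (auto simp: y_def z_def)
        then show ?thesis using i False by (auto simp: field_simps)
      qed
      \<comment> \<open>Both bases are non-zero, so both powers are 1.\<close>
      then have "x a ^ ?q1 - (x i - y' i * x a) ^ ?q1 = 0"
        using power_card_minus_1 False by (metis diff_self)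
      ultimately have "\<delta> y' x = 0"
        unfolding \<delta>_def using J(1) by (meson prod_zero)
      with neq show ?thesis by simp
    qed
    then have "\<phi> x = (\<Sum>y'\<in>vecs J. if y' = y then \<Sum>j<k. c y j * (x b ^ j * x a ^ (k - j)) else 0)"
      unfolding \<phi>_def by (intro sum.cong) auto
    also have "\<dots> = (\<Sum>j<k. c y j * (x b ^ j * x a ^ (k - j)))"
      using y by (simp add: finite_vecs[OF J(1)])
    also have "\<dots> = x a ^ k * (\<Sum>j<k. c y j * (x b / x a) ^ j)"
      unfolding sum_distrib_left
    proof (rule sum.cong)
      fix j assume "j \<in> {..<k}"
      then have "x a ^ k = x a ^ (k - j) * x a ^ j"
        by (simp flip: power_add)
      then show "c y j * (x b ^ j * x a ^ (k - j)) = x a ^ k * (c y j * (x b / x a) ^ j)"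
        using False by (simp add: power_divide)
    qed simp
    also have "(\<Sum>j<k. c y j * (x b / x a) ^ j) = h z"
    proof -
      have "(\<lambda>i. y i + x b / x a * e i) = z"
        using a by (auto simp: fun_eq_iff y_def z_def e_def)
      then show ?thesis using c[OF y, of "x b / x a"] by simp
    qed
    finally show ?thesis
      using x by (simp add: homogenize_def z_def)
  qed
  ultimately show thesis by (rule that)
qed

text \<open>Induction on the number of coordinates, splitting off one at a time and bringing both
  summands to the same degree. For \<open>I = {0..m}\<close> the number \<open>card I - 2\<close> is
  \<open>m - 1\<close>.\<close>

lemma planar_forms_eq_hom_fun:
  fixes F :: "(nat \<Rightarrow> 'a::{field,finite}) \<Rightarrow> 'a"
  assumes "finite I" "card I \<ge> 2" and k: "k \<ge> 1" and "F \<in> planar_forms I k"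
  shows "\<exists>\<phi>. hom_fun I (k + (card I - 2) * (CARD('a) - 1)) \<phi> \<and> (\<forall>x\<in>vecs I. \<phi> x = F x)"
  using assms(1,2,4)
proof (induction I arbitrary: F rule: finite_induct)
  case (insert a J)
  let ?I = "insert a J" and ?q1 = "CARD('a) - 1"
  have "J \<noteq> {}" using insert by auto
  then obtain b J' where J: "J = insert b J'" "b \<notin> J'"
    by (meson ex_in_conv mk_disjoint_insert)
  have fin: "finite J'" using insert.hyps J by simp
  show ?case
  proof (cases "J' = {}")
    case True
    \<comment> \<open>With two coordinates, the space is the plane of the two unit vectors, and
      \<open>F\<close> is itself a binary form.\<close>
    let ?u = "(\<lambda>i. 0)(a := 1) :: nat \<Rightarrow> 'a" and ?w = "(\<lambda>i. 0)(b := 1) :: nat \<Rightarrow> 'a"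
    have "?u \<in> vecs ?I" "?w \<in> vecs ?I" by (auto simp: vecs_def J)
    then have "binary_form k (\<lambda>s t. F (\<lambda>i. s * ?u i + t * ?w i))"
      by (rule planar_formsD[OF insert.prems(2)])
    from binary_form_imp_hom_fun[OF this, of a ?I b]
    have "hom_fun ?I k (\<lambda>x. F (\<lambda>i. x a * ?u i + x b * ?w i))"
      by (simp add: J)
    moreover have "(\<lambda>i. x a * ?u i + x b * ?w i) = x" if "x \<in> vecs ?I" for x
      using that insert.hyps True J by (auto simp: vecs_def fun_eq_iff)
    ultimately show ?thesis
      using insert.hyps True J by (auto simp: card_insert_if)
  next
    case False
    from insert.prems(2) insert.hyps(2) k obtain G h where
      G: "G \<in> planar_forms J k" and h: "h \<in> line_polys J k"
      and F: "F = (\<lambda>x. cone a ?I G x + homogenize a ?I k h x)"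
      by (rule planar_forms_decompose)
    have card: "card J = Suc (card J')" "card ?I = Suc (Suc (card J'))" "card J' \<ge> 1"
      using J fin insert.hyps False by (auto simp: Suc_le_eq card_gt_0_iff)
    from insert.IH[OF _ G] card obtain \<psi> where
      \<psi>: "hom_fun J (k + (card J' - 1) * ?q1) \<psi>" "\<And>x. x \<in> vecs J \<Longrightarrow> \<psi> x = G x"
      by auto
    \<comment> \<open>The restriction lives on one coordinate less, so its degree is
      \<open>q - 1\<close> short of the target.\<close>
    have "hom_fun J (k + card J' * ?q1) \<psi>"
    proof -
      have "(card J' - 1) * ?q1 + ?q1 = card J' * ?q1"
        using card(3) by (cases "card J'") auto
      then show ?thesis
        using hom_fun_raise_degree[OF \<psi>(1)] k by (simp add: add.assoc del: One_nat_def)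
    qed
    then obtain f where f: "f \<in> hom_polys J (k + card J' * ?q1)" "\<psi> = mv_eval f"
      by (auto simp: hom_fun_def)
    \<comment> \<open>As the variable with index \<open>a\<close> does not occur in
      \<open>f\<close>, the polynomial for \<open>G\<close> also represents its cone.\<close>
    have cone: "mv_eval f x = cone a ?I G x" if "x \<in> vecs ?I" for x
    proof -
      have "x(a := 0) \<in> vecs J" using that by (auto simp: vecs_def)
      then have "G (x(a := 0)) = mv_eval f (x(a := 0))" using \<psi>(2) f(2) by simp
      also have "\<dots> = mv_eval f x"
        by (rule mv_eval_cong[of f J]) (use f(1) insert.hyps in \<open>auto simp: hom_polys_def\<close>)
      finally show ?thesis using that by (simp add: cone_def)
    qed
    have a: "a \<notin> insert b J'" using insert.hyps J by simp
    obtain \<phi> where \<phi>: "hom_fun ?I (k + card J' * ?q1) \<phi>" "\<And>x. x \<in> vecs ?I \<Longrightarrow> \<phi> x = homogenize a ?I k h x"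
      using homogenize_eq_hom_fun[OF h[unfolded J(1)] fin J(2) a k] unfolding J(1) by metis
    have "hom_fun ?I (k + card J' * ?q1) (mv_eval f)"
      by (rule hom_fun_mono[of J]) (use f(1) in \<open>auto simp: hom_fun_def\<close>)
    from hom_fun_add[OF this \<phi>(1)] show ?thesis
      using cone \<phi>(2) F card(2) by auto
  qed
qed simp


section \<open>Lifted codes as function spaces\<close>

lemma mv_eval_scale:
  assumes "f \<in> hom_polys I v"
  shows "mv_eval f (\<lambda>i. c * x i) = c ^ v * mv_eval f x"
proof -
  have "mono_eval (\<lambda>i. c * x i) \<mu> = c ^ total_deg \<mu> * mono_eval x \<mu>" for \<mu>
    by (simp add: mono_eval_def total_deg_def power_mult_distrib prod.distrib power_sum)
  then show ?thesis
    using assms by (auto simp: mv_eval_eq sum_distrib_left hom_polys_iff intro!: sum.cong)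
qed

lemma exists_standard_representative:
  fixes x :: "nat \<Rightarrow> 'a::field"
  assumes "x \<in> vecs {0..m}" and "x \<noteq> (\<lambda>i. 0)"
  obtains c P where "P \<in> proj_points m" "x = (\<lambda>i. c * P i)"
proof -
  define j where "j = (LEAST j. x j \<noteq> 0)"
  have "\<exists>j. x j \<noteq> 0" using assms(2) by auto
  then have j: "x j \<noteq> 0" unfolding j_def by (rule LeastI_ex)
  have less: "x i = 0" if "i < j" for i
    using not_less_Least that unfolding j_def by blast
  have "j \<le> m" using assms(1) j by (fastforce simp: vecs_def)
  then have "(\<lambda>i. x i / x j) \<in> proj_points m"
    using assms(1) j less by (auto simp: proj_points_def vecs_def)
  moreover have "x = (\<lambda>i. x j * (x i / x j))" using j by simp
  ultimately show thesis by (rule that)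
qed

lemma proj_points_subset_vecs: "proj_points m \<subseteq> vecs {0..m}"
  by (auto simp: proj_points_def)

lemma planar_forms_0: "0 \<in> planar_forms I k"
  by (simp add: planar_forms_def binary_form_0 zero_fun_def)

text \<open>Every non-zero vector is a multiple of a standard representative, and homogeneity fixes
  its value. At the origin \<open>k \<ge> 1\<close> forces zero.\<close>

lemma planar_forms_eqI:
  fixes F G :: "(nat \<Rightarrow> 'a::field) \<Rightarrow> 'a"
  assumes F: "F \<in> planar_forms {0..m} k" and G: "G \<in> planar_forms {0..m} k" and k: "k \<ge> 1"
    and eq: "\<And>P. P \<in> proj_points m \<Longrightarrow> F P = G P"
  shows "F = G"
proof
  fix x :: "nat \<Rightarrow> 'a"
  consider "x \<notin> vecs {0..m}" | "x = (\<lambda>i. 0)" | "x \<in> vecs {0..m}" "x \<noteq> (\<lambda>i. 0)"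
    by blast
  then show "F x = G x"
  proof cases
    case 1
    then show ?thesis using planar_forms_outside F G by metis
  next
    case 2
    have "x \<in> vecs {0..m}" by (simp add: 2 vecs_def)
    from planar_forms_scale[OF F this, of 0] planar_forms_scale[OF G this, of 0] k
    show ?thesis by (simp add: 2 power_0_left)
  next
    case 3
    then obtain c P where P: "P \<in> proj_points m" and x: "x = (\<lambda>i. c * P i)"
      by (rule exists_standard_representative)
    have "P \<in> vecs {0..m}" using P proj_points_subset_vecs by blast
    then show ?thesis
      using planar_forms_scale[OF F, of P c] planar_forms_scale[OF G, of P c] eq[OF P] by (simp add: x)
  qed
qed

lemma linear_pairI:
  fixes u w :: "nat \<Rightarrow> 'a::field"
  shows "Vector_Spaces.linear pair_scale fun_scale (\<lambda>p i. fst p * u i + snd p * w i)"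
  unfolding Vector_Spaces.linear_iff
  by (auto simp: vector_space_pair_scale vector_space_fun_scale pair_scale_def fun_scale_def
      fun_eq_iff algebra_simps)

text \<open>Independent \<open>u\<close>, \<open>w\<close> give an embedding. The pullback agrees
  with a binary form on the projective line, hence on the plane, since both scale by
  \<open>c ^ k\<close>. For dependent vectors the pullback is a multiple of the \<open>k\<close>-th
  power of a linear form.\<close>

lemma hom_polys_in_planar_forms:
  fixes f :: "'a::{field,finite} mvpoly"
  assumes f: "f \<in> hom_polys {0..m} (k + n * (CARD('a) - 1))" and k: "k \<ge> 1"
    and L: "\<And>L. L \<in> Emb_P m \<Longrightarrow> ev_P 1 (comp_P f L) \<in> PRS k"
  shows "(\<lambda>x. if x \<in> vecs {0..m} then mv_eval f x else 0) \<in> planar_forms {0..m} k"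
proof -
  \<comment> \<open>The degree of \<open>f\<close> exceeds \<open>k\<close> by a multiple of
    \<open>q - 1\<close>, which powers of scalars ignore.\<close>
  have scale: "mv_eval f (\<lambda>i. c * x i) = c ^ k * mv_eval f x" for c x
    using mv_eval_scale[OF f] power_eq_power_add_card[OF k] by metis
  have "binary_form k (\<lambda>s t. mv_eval f (\<lambda>i. s * u i + t * w i))"
    if uw: "u \<in> vecs {0..m}" "w \<in> vecs {0..m}" for u w :: "nat \<Rightarrow> 'a"
  proof (cases "inj (\<lambda>p i. fst p * u i + snd p * w i)")
    case True
    define L where "L = (\<lambda>p i. fst p * u i + snd p * w i)"
    have "L \<in> Emb_P m"
      unfolding Emb_P_def using True linear_pairI[of u w] vecs_lin_comb[OF uw] by (auto simp: L_def)
    from L[OF this] obtain g where g: "g \<in> hom_polys {0..1} k" "ev_P 1 (comp_P f L) = ev_P 1 g"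
      by (auto simp: PRS_def)
    have fg: "mv_eval f (\<lambda>i. P 0 * u i + P 1 * w i) = mv_eval g P" if "P \<in> proj_points 1" for P
      using fun_cong[OF g(2), of P] that by (simp add: ev_P_def mv_eval_comp_P L_def mult.commute)
    have "mv_eval f (\<lambda>i. s * u i + t * w i) = mv_eval g ((\<lambda>i. 0)(0 := s, 1 := t))" for s t
    proof (cases "s = 0 \<and> t = 0")
      \<comment> \<open>The origin is no projective point; \<open>k \<ge> 1\<close> makes both sides
        zero there.\<close>
      case True
      then have "mv_eval f (\<lambda>i. s * u i + t * w i) = 0"
        using scale[of 0 u] k by (simp add: power_0_left)
      moreover have "mv_eval g (\<lambda>i. 0) = 0"
        using mv_eval_scale[OF g(1), of 0 u] k by (simp add: power_0_left)
      moreover have "(\<lambda>i. 0)(0 := s, 1 := t) = (\<lambda>i::nat. 0)" using True by auto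
      ultimately show ?thesis by (simp only:)
    next
      case False
      let ?x = "(\<lambda>i. 0)(0 := s, 1 := t) :: nat \<Rightarrow> 'a"
      have "?x \<in> vecs {0..1}" by (auto simp: vecs_def)
      moreover have "?x \<noteq> (\<lambda>i. 0)" using False by (auto simp: fun_eq_iff)
      ultimately obtain c P where P: "P \<in> proj_points 1" and x: "?x = (\<lambda>i. c * P i)"
        by (rule exists_standard_representative)
      have "s = c * P 0" "t = c * P 1"
        using fun_cong[OF x, of 0] fun_cong[OF x, of 1] by auto
      then have "mv_eval f (\<lambda>i. s * u i + t * w i) = mv_eval f (\<lambda>i. c * (P 0 * u i + P 1 * w i))"
        by (simp add: algebra_simps)
      also have "\<dots> = c ^ k * mv_eval g P"
        unfolding scale fg[OF P] ..
      finally show ?thesis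
        unfolding x using mv_eval_scale[OF g(1), of c P] by simp
    qed
    then show ?thesis
      using hom_polys_imp_binary_form[OF g(1)] by simp
  next
    case False
    \<comment> \<open>Two pairs with the same image give a non-trivial linear relation between
      \<open>u\<close> and \<open>w\<close>.\<close>
    then obtain p p' where "p \<noteq> p'"
      and eq: "\<And>i. fst p * u i + snd p * w i = fst p' * u i + snd p' * w i"
      unfolding inj_def fun_eq_iff by blast
    define \<alpha> \<beta> where "\<alpha> = fst p - fst p'" and "\<beta> = snd p - snd p'"
    have dep: "\<alpha> * u i + \<beta> * w i = 0" for i
      using eq[of i] by (simp add: \<alpha>_def \<beta>_def algebra_simps)
    consider "\<alpha> \<noteq> 0" | "\<beta> \<noteq> 0"
      using \<open>p \<noteq> p'\<close> by (auto simp: \<alpha>_def \<beta>_def prod_eq_iff)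
    then show ?thesis
    proof cases
      case 1
      have "u i = (- \<beta> / \<alpha>) * w i" for i
        using dep[of i] 1 by (simp add: field_simps eq_neg_iff_add_eq_0)
      then have lin: "(\<lambda>i. s * u i + t * w i) = (\<lambda>i. ((- \<beta> / \<alpha>) * s + 1 * t) * w i)" for s t
        by (simp add: fun_eq_iff algebra_simps)
      have "mv_eval f (\<lambda>i. s * u i + t * w i) = mv_eval f w * ((- \<beta> / \<alpha>) * s + 1 * t) ^ k" for s t
        unfolding lin scale by (rule mult.commute)
      then show ?thesis
        using binary_form_cmult[OF binary_form_linear_power] by (simp only:)
    next
      case 2
      have "w i = (- \<alpha> / \<beta>) * u i" for i
        using dep[of i] 2 by (simp add: field_simps eq_neg_iff_add_eq_0)
      then have lin: "(\<lambda>i. s * u i + t * w i) = (\<lambda>i. (1 * s + (- \<alpha> / \<beta>) * t) * u i)" for s t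
        by (simp add: fun_eq_iff algebra_simps)
      have "mv_eval f (\<lambda>i. s * u i + t * w i) = mv_eval f u * (1 * s + (- \<alpha> / \<beta>) * t) ^ k" for s t
        unfolding lin scale by (rule mult.commute)
      then show ?thesis
        using binary_form_cmult[OF binary_form_linear_power] by (simp only:)
    qed
  qed
  then show ?thesis
    by (simp add: planar_forms_def vecs_lin_comb)
qed

text \<open>The inclusion from right to left needs a polynomial of the prescribed degree for each
  planar form, which \<open>planar_forms_eq_hom_fun\<close> supplies. Its pullbacks have the values
  of \<open>F\<close> on planes, hence those of binary forms.\<close>

lemma PLift_eq_planar_forms:
  fixes m k :: nat
  assumes m: "m \<ge> 1" and k: "k \<ge> 1"
  shows "PLift m k = (\<lambda>F P. if P \<in> proj_points m then F P else 0) `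
    (planar_forms {0..m} k :: ((nat \<Rightarrow> 'a::{field,finite}) \<Rightarrow> 'a) set)" (is "_ = ?R ` _")
proof (intro equalityI subsetI)
  fix c :: "(nat \<Rightarrow> 'a) \<Rightarrow> 'a"
  assume "c \<in> PLift m k"
  then obtain f where c: "c = ev_P m f" and f: "f \<in> hom_polys {0..m} (k + (m - 1) * (CARD('a) - 1))"
    and L: "\<And>L. L \<in> Emb_P m \<Longrightarrow> ev_P 1 (comp_P f L) \<in> PRS k"
    by (auto simp: PLift_def)
  have "c = ?R (\<lambda>x. if x \<in> vecs {0..m} then mv_eval f x else 0)"
    using proj_points_subset_vecs by (fastforce simp: c ev_P_def fun_eq_iff)
  then show "c \<in> ?R ` planar_forms {0..m} k"
    by (rule image_eqI[where x = "\<lambda>x. if x \<in> vecs {0..m} then mv_eval f x else 0"])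
      (rule hom_polys_in_planar_forms[OF f k L])
next
  fix c :: "(nat \<Rightarrow> 'a) \<Rightarrow> 'a"
  assume "c \<in> ?R ` planar_forms {0..m} k"
  then obtain F where F: "F \<in> planar_forms {0..m} k" and c: "c = ?R F" by blast
  from planar_forms_eq_hom_fun[OF _ _ k F] m obtain f where
    f: "f \<in> hom_polys {0..m} (k + (m - 1) * (CARD('a) - 1))"
    and fF: "\<And>x. x \<in> vecs {0..m} \<Longrightarrow> mv_eval f x = F x"
    by (auto simp: hom_fun_def numeral_2_eq_2)
  have "ev_P 1 (comp_P f L) \<in> PRS k" if "L \<in> Emb_P m" for L
  proof -
    have L: "L (1, 0) \<in> vecs {0..m}" "L (0, 1) \<in> vecs {0..m}"
      using that by (auto simp: Emb_P_def)
    from binary_form_imp_hom_fun[OF planar_formsD[OF F L], of 0 "{0..1}" 1]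
    obtain g where g: "g \<in> hom_polys {0..1} k"
      and eq: "(\<lambda>x. F (\<lambda>i. x 0 * L (1, 0) i + x 1 * L (0, 1) i)) = mv_eval g"
      by (auto simp: hom_fun_def)
    have "mv_eval (comp_P f L) x = mv_eval g x" for x
      using fun_cong[OF eq, of x] fF[OF vecs_lin_comb[OF L]] by (simp add: mv_eval_comp_P mult.commute)
    then have "ev_P 1 (comp_P f L) = ev_P 1 g"
      unfolding ev_P_def by presburger
    with g show ?thesis by (auto simp: PRS_def)
  qed
  moreover have "c = ev_P m f"
    using fF proj_points_subset_vecs by (fastforce simp: c ev_P_def fun_eq_iff)
  ultimately show "c \<in> PLift m k"
    using f by (auto simp: PLift_def)
qed

lemma card_PLift:
  assumes "m \<ge> 1" "k \<ge> 1"
  shows "card (PLift m k :: ((nat \<Rightarrow> 'a::{field,finite}) \<Rightarrow> 'a) set) =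
    card (planar_forms {0..m} k :: ((nat \<Rightarrow> 'a) \<Rightarrow> 'a) set)"
  unfolding PLift_eq_planar_forms[OF assms]
proof (rule card_image, rule inj_onI)
  fix F G :: "(nat \<Rightarrow> 'a) \<Rightarrow> 'a"
  assume FG: "F \<in> planar_forms {0..m} k" "G \<in> planar_forms {0..m} k"
    and eq: "(\<lambda>P. if P \<in> proj_points m then F P else 0) = (\<lambda>P. if P \<in> proj_points m then G P else 0)"
  show "F = G"
    by (rule planar_forms_eqI[OF FG \<open>k \<ge> 1\<close>]) (use fun_cong[OF eq] in presburger)
qed

section \<open>The affine side\<close>

lemma Emb_A_I:
  fixes u w :: "nat \<Rightarrow> 'a::field"
  assumes uw: "u \<in> vecs {1..m}" "w \<in> vecs {1..m}" and "w \<noteq> (\<lambda>i. 0)"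
  shows "(\<lambda>p i. fst p * u i + snd p * w i) \<in> Emb_A m" (is "?L \<in> _")
proof -
  have w0: "w 0 = 0" using uw by (simp add: vecs_def)
  \<comment> \<open>Choosing \<open>fst\<close> as zeroth coordinate gives \<open>u\<close> the
    zeroth entry 1. That coordinate recovers the first component of \<open>p\<close>, and a non-zero
    entry of \<open>w\<close> then recovers the second.\<close>
  have eq: "(\<lambda>p. (?L p)(0 := fst p)) = (\<lambda>p i. fst p * (u(0 := 1)) i + snd p * w i)"
    using w0 by (auto simp: fun_eq_iff)
  obtain j where j: "w j \<noteq> 0" using assms(3) by auto
  have "inj (\<lambda>p i. fst p * (u(0 := 1)) i + snd p * w i)"
  proof (rule injI)
    fix p p' :: "'a \<times> 'a"
    assume *: "(\<lambda>i. fst p * (u(0 := 1)) i + snd p * w i) = (\<lambda>i. fst p' * (u(0 := 1)) i + snd p' * w i)"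
    from fun_cong[OF *, of 0] have "fst p = fst p'" by (simp add: w0)
    moreover from this fun_cong[OF *, of j] have "snd p = snd p'" using j by simp
    ultimately show "p = p'" by (simp add: prod_eq_iff)
  qed
  moreover have "u(0 := 1) \<in> vecs {0..m}" "w \<in> vecs {0..m}"
    using uw by (auto simp: vecs_def)
  then have "range (\<lambda>p i. fst p * (u(0 := 1)) i + snd p * w i) \<subseteq> vecs {0..m}"
    using vecs_lin_comb by blast
  ultimately have "(\<lambda>p. (?L p)(0 := fst p)) \<in> Emb_P m"
    unfolding eq Emb_P_def using linear_pairI by blast
  then show ?thesis
    unfolding Emb_A_def using linear_pairI[of u w] vecs_lin_comb[OF uw] by blast
qed

text \<open>Every line with non-zero direction comes from an embedding. Conversely, every function
  on \<open>vecs {1..m}\<close> is polynomial, and \<open>Lift\<close> puts no bound on the degree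
  of \<open>f\<close> itself.\<close>

lemma Lift_eq_line_polys:
  fixes m k :: nat
  assumes k: "k \<ge> 1"
  shows "Lift m (k - 1) = (line_polys {1..m} k :: ((nat \<Rightarrow> 'a::{field,finite}) \<Rightarrow> 'a) set)"
proof (intro equalityI subsetI)
  fix h :: "(nat \<Rightarrow> 'a) \<Rightarrow> 'a"
  assume "h \<in> Lift m (k - 1)"
  then obtain f where h: "h = ev_A m f"
    and RS: "\<And>L. L \<in> Emb_A m \<Longrightarrow> poly (comp_A f L) \<in> RS (k - 1)"
    by (auto simp: Lift_def)
  show "h \<in> line_polys {1..m} k"
    unfolding line_polys_def
  proof (intro CollectI conjI ballI allI impI)
    fix u w :: "nat \<Rightarrow> 'a"
    assume uw: "u \<in> vecs {1..m}" "w \<in> vecs {1..m}"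
    show "\<exists>c. \<forall>t. h (\<lambda>i. u i + t * w i) = (\<Sum>i<k. c i * t ^ i)"
    proof (cases "w = (\<lambda>i. 0)")
      \<comment> \<open>For direction zero the function is constant, which the bound admits because
        \<open>k \<ge> 1\<close>.\<close>
      case True
      have "(\<Sum>i<k. (if i = 0 then h u else 0) * t ^ i) = (\<Sum>i<k. if i = 0 then h u else 0)" for t
        by (rule sum.cong) auto
      then have "(\<Sum>i<k. (if i = 0 then h u else 0) * t ^ i) = h u" for t
        using k by simp
      then show ?thesis
        using True by (intro exI[of _ "\<lambda>i. if i = 0 then h u else 0"]) simp
    next
      case False
      from RS[OF Emb_A_I[OF uw False]] obtain g where g: "degree g \<le> k - 1"
        and eq: "poly (comp_A f (\<lambda>p i. fst p * u i + snd p * w i)) = poly g"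
        by (auto simp: RS_def)
      have "h (\<lambda>i. u i + t * w i) = (\<Sum>i<k. coeff g i * t ^ i)" for t
      proof -
        have "h (\<lambda>i. u i + t * w i) = poly g t"
          using fun_cong[OF eq, of t] vecs_lin_comb[OF uw, of 1 t]
          by (simp add: h ev_A_def poly_comp_A)
        also have "\<dots> = (\<Sum>i<k. coeff g i * t ^ i)"
          unfolding poly_altdef using g k
          by (intro sum.mono_neutral_left) (auto simp: coeff_eq_0)
        finally show ?thesis .
      qed
      then show ?thesis by blast
    qed
  qed (simp add: h ev_A_def)
next
  fix h :: "(nat \<Rightarrow> 'a) \<Rightarrow> 'a"
  assume h: "h \<in> line_polys {1..m} k"
  obtain \<phi> where "poly_fun {1..m} \<phi>" "\<And>x. x \<in> vecs {1..m} \<Longrightarrow> \<phi> x = h x"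
    using poly_fun_exists[of "{1..m}"] by blast
  then obtain f where f: "f \<in> polys_in {1..m}" and fh: "\<And>x. x \<in> vecs {1..m} \<Longrightarrow> mv_eval f x = h x"
    by (auto simp: poly_fun_def)
  have "poly (comp_A f L) \<in> RS (k - 1)" if "L \<in> Emb_A m" for L
  proof -
    have L: "L (1, 0) \<in> vecs {1..m}" "L (0, 1) \<in> vecs {1..m}"
      using that by (auto simp: Emb_A_def)
    then obtain c where c: "\<And>t. h (\<lambda>i. L (1, 0) i + t * L (0, 1) i) = (\<Sum>i<k. c i * t ^ i)"
      using h unfolding line_polys_def by blast
    have "poly (comp_A f L) t = poly (\<Sum>i<k. monom (c i) i) t" for t
      using fh[OF vecs_lin_comb[OF L, of 1 t]] c[of t]
      by (simp add: poly_comp_A poly_sum poly_monom)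
    moreover have "degree (\<Sum>i<k. monom (c i) i) \<le> k - 1"
      by (intro degree_sum_le) (auto intro: order_trans[OF degree_monom_le])
    ultimately show ?thesis
      unfolding RS_def by blast
  qed
  moreover have "h = ev_A m f"
    using fh line_polys_outside[OF h] by (auto simp: ev_A_def)
  ultimately show "h \<in> Lift m (k - 1)"
    using f by (auto simp: Lift_def)
qed


section \<open>Dimensions by counting\<close>

interpretation fun_space: vector_space fun_scale
  by (rule vector_space_fun_scale)

text \<open>Each new basis vector multiplies the count by \<open>q\<close>: the map
  \<open>(c, x) \<mapsto> c b + x\<close> is injective because \<open>b\<close> lies outside the
  span.\<close>

lemma card_span_independent:
  fixes B :: "('b \<Rightarrow> 'a::{field,finite}) set"
  assumes "finite B" "fun_space.independent B"
  shows "card (fun_space.span B) = CARD('a) ^ card B"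
  using assms
proof (induction B rule: finite_induct)
  case (insert b B)
  have b: "b \<notin> fun_space.span B" and B: "fun_space.independent B"
    using insert by (auto simp: fun_space.independent_insert)
  let ?f = "\<lambda>(c, x). fun_scale c b + x"
  have "fun_space.span (insert b B) = ?f ` (UNIV \<times> fun_space.span B)"
  proof (intro equalityI subsetI)
    fix x assume "x \<in> fun_space.span (insert b B)"
    then obtain c where "x - fun_scale c b \<in> fun_space.span B"
      by (auto simp: fun_space.span_insert)
    then show "x \<in> ?f ` (UNIV \<times> fun_space.span B)"
      by (intro image_eqI[of _ _ "(c, x - fun_scale c b)"]) auto
  next
    fix x assume "x \<in> ?f ` (UNIV \<times> fun_space.span B)"
    then obtain c y where "y \<in> fun_space.span B" "x = fun_scale c b + y" by auto
    then have "x - fun_scale c b \<in> fun_space.span B" by simp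
    then show "x \<in> fun_space.span (insert b B)"
      by (auto simp: fun_space.span_insert)
  qed
  moreover have "inj_on ?f (UNIV \<times> fun_space.span B)"
  proof (rule inj_onI, clarify)
    fix c x c' x'
    assume x: "x \<in> fun_space.span B" "x' \<in> fun_space.span B"
      and eq: "fun_scale c b + x = fun_scale c' b + x'"
    have diff: "fun_scale (c - c') b = x' - x"
      using eq by (simp add: fun_space.scale_left_diff_distrib algebra_simps)
    have "c = c'"
    proof (rule ccontr)
      assume "c \<noteq> c'"
      moreover have "fun_scale (c - c') b \<in> fun_space.span B"
        unfolding diff using x by (intro fun_space.span_diff)
      then have "fun_scale (inverse (c - c')) (fun_scale (c - c') b) \<in> fun_space.span B"
        by (rule fun_space.span_scale)
      ultimately show False using b by simp
    qed
    with eq show "c = c' \<and> x = x'" by simp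
  qed
  ultimately show ?case
    using insert B by (simp add: card_image card_cartesian_product)
qed simp

text \<open>Turns the dimension formula into an identity between cardinalities, for which bijections
  suffice.\<close>

lemma card_eq_power_code_dim:
  fixes S :: "('b \<Rightarrow> 'a::{field,finite}) set"
  assumes "finite S" "fun_space.subspace S"
  shows "card S = CARD('a) ^ code_dim S"
proof -
  obtain B where B: "B \<subseteq> S" "fun_space.independent B" "S \<subseteq> fun_space.span B" "card B = code_dim S"
    using fun_space.basis_exists by blast
  then have "fun_space.span B = S"
    using fun_space.span_subspace assms(2) by blast
  then show ?thesis
    using card_span_independent[of B] B finite_subset[OF B(1) assms(1)] by simp
qed

section \<open>The codes as finite subspaces\<close>

lemma finite_functions_on_vecs:
  assumes "finite I"
  shows "finite {F :: (nat \<Rightarrow> 'a::{field,finite}) \<Rightarrow> 'a. \<forall>x. x \<notin> vecs I \<longrightarrow> F x = 0}"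
  using finite_set_of_finite_funs[OF finite_vecs[OF assms] finite, of UNIV 0]
  by (rule finite_subset[rotated]) auto

lemma subspace_planar_forms: "fun_space.subspace (planar_forms I k)"
proof (rule fun_space.subspaceI)
  show "0 \<in> planar_forms I k" by (rule planar_forms_0)
  fix F :: "(nat \<Rightarrow> 'a) \<Rightarrow> 'a" assume F: "F \<in> planar_forms I k"
  show "F + G \<in> planar_forms I k" if "G \<in> planar_forms I k" for G
    using planar_forms_lin_comb[OF F that, of 1] by (simp add: plus_fun_def)
  show "fun_scale c F \<in> planar_forms I k" for c
    using planar_forms_lin_comb[OF planar_forms_0 F, of c] by (simp add: fun_scale_def)
qed

lemma subspace_line_polys: "fun_space.subspace (line_polys J k)"
proof (rule fun_space.subspaceI)
  show z: "0 \<in> line_polys J k"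
    by (auto simp: line_polys_def zero_fun_def intro!: exI[of _ "\<lambda>i. 0"])
  fix F :: "(nat \<Rightarrow> 'a) \<Rightarrow> 'a" assume F: "F \<in> line_polys J k"
  show "F + G \<in> line_polys J k" if "G \<in> line_polys J k" for G
    using line_polys_lin_comb[OF F that, of 1] by (simp add: plus_fun_def)
  show "fun_scale c F \<in> line_polys J k" for c
    using line_polys_lin_comb[OF z F, of c] by (simp add: fun_scale_def)
qed

lemma subspace_PLift:
  assumes "m \<ge> 1" "k \<ge> 1"
  shows "fun_space.subspace (PLift m k :: ((nat \<Rightarrow> 'a::{field,finite}) \<Rightarrow> 'a) set)"
proof -
  have "Vector_Spaces.linear fun_scale fun_scale
      (\<lambda>F P. if P \<in> proj_points m then F P else (0::'a))"
    unfolding Vector_Spaces.linear_iff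
    by (auto simp: vector_space_fun_scale fun_scale_def fun_eq_iff)
  then interpret Vector_Spaces.linear fun_scale fun_scale "\<lambda>F P. if P \<in> proj_points m then F P else (0::'a)" .
  show ?thesis
    unfolding PLift_eq_planar_forms[OF assms]
    by (rule subspace_image[OF subspace_planar_forms])
qed

lemma card_PLift_eq_power_code_dim:
  assumes "m \<ge> 1" "k \<ge> 1"
  shows "card (PLift m k :: ((nat \<Rightarrow> 'a::{field,finite}) \<Rightarrow> 'a) set) =
    CARD('a) ^ code_dim (PLift m k :: ((nat \<Rightarrow> 'a) \<Rightarrow> 'a) set)"
proof (rule card_eq_power_code_dim)
  have "finite (planar_forms {0..m} k :: ((nat \<Rightarrow> 'a) \<Rightarrow> 'a) set)"
    by (rule finite_subset[OF _ finite_functions_on_vecs[of "{0..m}"]]) (auto simp: planar_forms_def)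
  then show "finite (PLift m k :: ((nat \<Rightarrow> 'a) \<Rightarrow> 'a) set)"
    unfolding PLift_eq_planar_forms[OF assms] by (rule finite_imageI)
qed (rule subspace_PLift[OF assms])

text \<open>The hyperplane \<open>x 0 = 0\<close> carries the coordinates \<open>1, ..., m\<close>,
  while \<open>PLift (m - 1) k\<close> uses \<open>0, ..., m - 1\<close>; a transposition relabels
  one set as the other.\<close>

lemma card_planar_forms_transpose:
  "card (planar_forms (transpose a b ` I) k :: ((nat \<Rightarrow> 'a::field) \<Rightarrow> 'a) set) =
   card (planar_forms I k :: ((nat \<Rightarrow> 'a) \<Rightarrow> 'a) set)"
proof -
  let ?\<tau> = "transpose a b"
  let ?T = "\<lambda>(F :: (nat \<Rightarrow> 'a) \<Rightarrow> 'a) x. F (x \<circ> ?\<tau>)"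
  have vecs: "x \<circ> ?\<tau> \<in> vecs I \<longleftrightarrow> x \<in> vecs (?\<tau> ` I)" for x :: "nat \<Rightarrow> 'a" and I
    unfolding vecs_def by (auto simp: image_iff) (metis transpose_involutory)+
  have T: "?T F \<in> planar_forms (?\<tau> ` I) k" if F: "F \<in> planar_forms I k" for F I
    unfolding planar_forms_def
  proof (intro CollectI conjI ballI allI impI)
    fix u w :: "nat \<Rightarrow> 'a"
    assume "u \<in> vecs (?\<tau> ` I)" "w \<in> vecs (?\<tau> ` I)"
    then have "u \<circ> ?\<tau> \<in> vecs I" "w \<circ> ?\<tau> \<in> vecs I" by (simp_all add: vecs)
    from planar_formsD[OF F this]
    show "binary_form k (\<lambda>s t. F ((\<lambda>i. s * u i + t * w i) \<circ> ?\<tau>))"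
      by (simp add: comp_def)
  qed (use planar_forms_outside[OF F] vecs in blast)
  have "bij_betw ?T (planar_forms I k) (planar_forms (?\<tau> ` I) k)"
  proof (rule bij_betw_byWitness[where f' = ?T])
    show "?T ` planar_forms (?\<tau> ` I) k \<subseteq> planar_forms I k"
      using T[of _ "?\<tau> ` I"] by (auto simp: image_comp)
  qed (use T in \<open>auto simp: comp_assoc\<close>)
  then show ?thesis by (metis bij_betw_same_card)
qed

theorem corollary27:
  fixes m k :: nat
  assumes "m \<ge> 2" and "1 \<le> k" and "k \<le> CARD('a::{field,finite}) - 1"
  shows "code_dim (PLift m k :: ((nat \<Rightarrow> 'a) \<Rightarrow> 'a) set) =
         code_dim (PLift (m - 1) k :: ((nat \<Rightarrow> 'a) \<Rightarrow> 'a) set) +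
         code_dim (Lift m (k - 1) :: ((nat \<Rightarrow> 'a) \<Rightarrow> 'a) set)"
proof -
  have m: "m \<ge> 1" "m - 1 \<ge> 1" using assms(1) by auto
  have "transpose 0 m ` {1..m} = {0..m - 1}"
  proof -
    have "transpose 0 m ` {1..m} = transpose 0 m ` (insert m {1..m - 1})"
      using m by (intro arg_cong[where f = "image _"]) auto
    also have "\<dots> = insert 0 {1..m - 1}"
      using m by (auto simp: image_iff transpose_def intro!: bexI)
    finally show ?thesis by auto
  qed
  then have shift: "card (planar_forms {1..m} k :: ((nat \<Rightarrow> 'a) \<Rightarrow> 'a) set) =
      card (planar_forms {0..m - 1} k :: ((nat \<Rightarrow> 'a) \<Rightarrow> 'a) set)"
    using card_planar_forms_transpose[of 0 m "{1..m}" k] by metis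
  have "finite (line_polys {1..m} k :: ((nat \<Rightarrow> 'a) \<Rightarrow> 'a) set)"
    by (rule finite_subset[OF _ finite_functions_on_vecs[of "{1..m}"]]) (auto simp: line_polys_def)
  from card_eq_power_code_dim[OF this subspace_line_polys]
  have Lift: "card (line_polys {1..m} k :: ((nat \<Rightarrow> 'a) \<Rightarrow> 'a) set) =
      CARD('a) ^ code_dim (Lift m (k - 1) :: ((nat \<Rightarrow> 'a) \<Rightarrow> 'a) set)"
    unfolding Lift_eq_line_polys[OF assms(2)] .
  \<comment> \<open>Coordinate 0 is the one split off, separating the hyperplane at infinity from
    the affine chart.\<close>
  have "insert 0 {1..m} = {0..m}" by auto
  then have "card (planar_forms {0..m} k :: ((nat \<Rightarrow> 'a) \<Rightarrow> 'a) set) =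
      card (planar_forms {1..m} k :: ((nat \<Rightarrow> 'a) \<Rightarrow> 'a) set) *
      card (line_polys {1..m} k :: ((nat \<Rightarrow> 'a) \<Rightarrow> 'a) set)"
    using card_planar_forms_insert[of 0 "{1..m}" k, where 'a = 'a] assms(2) by simp
  then have "CARD('a) ^ code_dim (PLift m k :: ((nat \<Rightarrow> 'a) \<Rightarrow> 'a) set) =
      CARD('a) ^ (code_dim (PLift (m - 1) k :: ((nat \<Rightarrow> 'a) \<Rightarrow> 'a) set) +
        code_dim (Lift m (k - 1) :: ((nat \<Rightarrow> 'a) \<Rightarrow> 'a) set))"
    unfolding shift Lift card_PLift[OF m(1) assms(2), symmetric] card_PLift[OF m(2) assms(2), symmetric]
      card_PLift_eq_power_code_dim[OF m(1) assms(2)] card_PLift_eq_power_code_dim[OF m(2) assms(2)]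
      power_add .
  \<comment> \<open>The base is \<open>q \<ge> 2\<close>, so equal powers have equal
    exponents.\<close>
  then show ?thesis
    using CARD_finite_field_ge_2[where 'a = 'a] by (simp add: power_inject_exp)
qed

end
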